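(* Let $n\ge 1$. If $v\in\mathbb{R}^n$ is heavy, then for any $\epsilon>0$, $\dim_H(\mathbf{Bad}^\epsilon(v))<n$. In fact, if $(\eta_i)$ is a sequence of non-negative numbers with $\eta_i\to0$, then for any $\epsilon>0$ there exists $\delta=\delta(\epsilon,(\eta_i))>0$ such that for any $v\in\mathbb{R}^n$ for which $x_v\in\mathcal{H}(\eta_i)$, $$\dim_H(\mathbf{Bad}^\epsilon(v))\le n-\delta.$$
   Context: For $t\in\mathbb{R}^n$, $\langle t\rangle$ denotes the (Euclidean) distance from $t$ to $\mathbb{Z}^n$. For $v\in\mathbb{R}^n$ and $\epsilon>0$, $\mathbf{Bad}^\epsilon(v)=\{w\in\mathbb{R}^n:\liminf_{k\to\infty}k^{1/n}\langle kv-w\rangle\ge\epsilon\}$, $k$ ranging over positive integers. $\dim_H$ is Hausdorff dimension for the Euclidean metric. Put $d=n+1$ and $a_t=\mathrm{diag}(e^t,\dots,e^t,e^{-nt})\in\mathrm{SL}_d(\mathbb{R})$. $X\simeq\mathrm{SL}_d(\mathbb{R})/\mathrm{SL}_d(\mathbb{Z})$ is the space of unimodular (covolume 1) lattices in $\mathbb{R}^d$. For $v\in\mathbb{R}^n$ let $x_v=\begin{pmatrix}I_n&v\\0&1\end{pmatrix}\mathbb{Z}^d\in X$. Let $\mathscr{P}(X)$ be the space of Borel probability measures on $X$, viewed inside the dual of $C_0(X)$ with the weak* topology. For $x\in X$ and an integer $T\ge1$ let $\delta_x^T=\frac1T\sum_{i=0}^{T-1}\delta_{a_1^i x}$, where $\delta_z$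 is the Dirac mass at $z$. Let $\{\delta_x^T\}^\omega$ denote the set of weak* accumulation points, i.e. limits of $\delta_x^{T_k}$ along sequences $T_k\to\infty$. A lattice $x$ is heavy if $\{\delta_x^T\}^\omega\cap\mathscr{P}(X)\neq\varnothing$; a vector $v\in\mathbb{R}^n$ is heavy if the lattice $x_v$ is heavy. Fix once and for all functions $\psi_i\in C_c(X)$ with $0\le\psi_i\le1$ such that $\psi_i^{-1}(1)$ is an increasing sequence of compact sets covering $X$. For a sequence of non-negative numbers $\eta_i\to0$ put $\mathscr{P}(X,(\eta_i))=\{\mu\in\mathscr{P}(X):\forall i,\ \int\psi_i\,d\mu\ge1-\eta_i\}$ and $\mathcal{H}(\eta_i)=\{x\in X:\{\delta_x^T\}^\omega\cap\mathscr{P}(X,(\eta_i))\ne\varnothing\}$. *)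

theory Defs
  imports "HOL-Probability.Probability"
begin

definition integer_vectors :: "(real ^ 'd) set" where
  "integer_vectors = {x. \<forall>i. x $ i \<in> \<int>}"

definition dist_to_integers :: "real ^ 'd \<Rightarrow> real" where
  "dist_to_integers t = infdist t integer_vectors"

text \<open>The lower limit is taken in the extended reals. The term for \<open>k = 0\<close> does not affect it.\<close>

definition Bad :: "real \<Rightarrow> real ^ 'n \<Rightarrow> (real ^ 'n) set" where
  "Bad \<epsilon> v = {w. ereal \<epsilon> \<le>
     liminf (\<lambda>k. ereal (real k powr (1 / real CARD('n)) * dist_to_integers (real k *\<^sub>R v - w)))}"


section \<open>Hausdorff dimension\<close>

text \<open>
  The weight of a covering set is \<open>(diam U)\<^sup>s\<close>, with the usual conventions that the empty set
  has weight 0 and that \<open>0\<^sup>0 = 1\<close> (whereas \<open>0 powr 0 = 0\<close>). Covering sets are required to be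
  bounded because \<^const>\<open>diameter\<close> is real-valued and meaningless on unbounded sets.
\<close>

definition hausdorff_weight :: "real \<Rightarrow> 'a::metric_space set \<Rightarrow> ennreal" where
  "hausdorff_weight s U =
     (if U = {} then 0 else if s = 0 then 1 else ennreal (diameter U powr s))"

definition hausdorff_premeasure :: "real \<Rightarrow> real \<Rightarrow> 'a::metric_space set \<Rightarrow> ennreal" where
  "hausdorff_premeasure s r A =
     (INF U \<in> {U :: nat \<Rightarrow> 'a set. A \<subseteq> (\<Union>i. U i) \<and> (\<forall>i. bounded (U i) \<and> diameter (U i) \<le> r)}.
        \<Sum>i. hausdorff_weight s (U i))"

definition hausdorff_measure :: "real \<Rightarrow> 'a::metric_space set \<Rightarrow> ennreal" where
  "hausdorff_measure s A = (SUP r \<in> {0<..}. hausdorff_premeasure s r A)"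

definition hausdorff_dim :: "'a::metric_space set \<Rightarrow> ereal" where
  "hausdorff_dim A = (INF s \<in> {s. 0 \<le> s \<and> hausdorff_measure s A = 0}. ereal s)"


section \<open>The space of unimodular lattices\<close>

definition SL :: "(real ^ 'd ^ 'd) set" where
  "SL = {g. det g = 1}"

text \<open>
  The coset \<open>g SL(d,\<int>)\<close> is identified with the lattice \<open>g \<int>\<^sup>d\<close>; the topology is the quotient
  topology along \<open>SL(d,\<real>) \<rightarrow> X, g \<mapsto> g \<int>\<^sup>d\<close>.
\<close>

typedef ('d::finite) unimodular_lattice =
  "{L :: (real ^ 'd) set. \<exists>g \<in> SL. L = (\<lambda>z. g *v z) ` integer_vectors}"
proof
  show "(\<lambda>z. mat 1 *v z) ` integer_vectors \<in>
    {L :: (real ^ 'd) set. \<exists>g \<in> SL. L = (\<lambda>z. g *v z) ` integer_vectors}"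
    unfolding SL_def by (intro CollectI bexI[of _ "mat 1"]) simp_all
qed

definition lattice_of :: "real ^ 'd ^ 'd \<Rightarrow> 'd::finite unimodular_lattice" where
  "lattice_of g = Abs_unimodular_lattice ((\<lambda>z. g *v z) ` integer_vectors)"

lemma Rep_lattice_of:
  "g \<in> SL \<Longrightarrow> Rep_unimodular_lattice (lattice_of g) = (\<lambda>z. g *v z) ` integer_vectors"
  unfolding lattice_of_def by (rule Abs_unimodular_lattice_inverse) auto

lemma lattice_of_surj: "\<exists>g \<in> SL. L = lattice_of g"
proof -
  obtain g where "g \<in> SL" "Rep_unimodular_lattice L = (\<lambda>z. g *v z) ` integer_vectors"
    using Rep_unimodular_lattice[of L] by auto
  then show ?thesis
    by (metis Rep_lattice_of Rep_unimodular_lattice_inject)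
qed

instantiation unimodular_lattice :: (finite) topological_space
begin

definition open_unimodular_lattice :: "'a unimodular_lattice set \<Rightarrow> bool" where
  "open_unimodular_lattice U \<longleftrightarrow> openin (top_of_set SL) {g \<in> SL. lattice_of g \<in> U}"

instance
proof
  show "open (UNIV :: 'a unimodular_lattice set)"
    by (simp add: open_unimodular_lattice_def)
next
  fix S T :: "'a unimodular_lattice set"
  assume "open S" "open T"
  moreover have "{g \<in> SL. lattice_of g \<in> S \<inter> T} =
      {g \<in> SL. lattice_of g \<in> S} \<inter> {g \<in> SL. lattice_of g \<in> T}"
    by auto
  ultimately show "open (S \<inter> T)"
    by (simp add: open_unimodular_lattice_def openin_Int)
next
  fix K :: "'a unimodular_lattice set set"
  assume "\<forall>S\<in>K. open S"
  moreover have "{g \<in> SL. lattice_of g \<in> \<Union>K} = (\<Union>S\<in>K. {g \<in> SL. lattice_of g \<in> S})"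
    by auto
  ultimately show "open (\<Union>K)"
    unfolding open_unimodular_lattice_def by (auto intro: openin_Union)
qed

end

definition lattice_act ::
    "real ^ 'd ^ 'd \<Rightarrow> 'd::finite unimodular_lattice \<Rightarrow> 'd unimodular_lattice" where
  "lattice_act g L = Abs_unimodular_lattice ((\<lambda>z. g *v z) ` Rep_unimodular_lattice L)"

lemma lattice_act_lattice_of:
  assumes "h \<in> SL"
  shows "lattice_act g (lattice_of h) = lattice_of (g ** h)"
  unfolding lattice_act_def Rep_lattice_of[OF assms]
  by (simp add: lattice_of_def image_image matrix_vector_mul_assoc)


section \<open>The diagonal flow\<close>

text \<open>
  For index type \<open>'n\<close> of size \<open>n\<close>, the space \<open>\<real>\<^sup>d\<close> with \<open>d = n + 1\<close> is \<open>real ^ 'n option\<close>, where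
  \<open>None\<close> is the last coordinate.
\<close>

definition diag_elt :: "real \<Rightarrow> real ^ 'n::finite option ^ 'n option" where
  "diag_elt t = (\<chi> i j. if i \<noteq> j then 0
     else case i of Some _ \<Rightarrow> exp t | None \<Rightarrow> exp (- real CARD('n) * t))"

definition unip_elt :: "real ^ 'n::finite \<Rightarrow> real ^ 'n option ^ 'n option" where
  "unip_elt v = (\<chi> i j. if i = j then 1
     else case (i, j) of (Some a, None) \<Rightarrow> v $ a | _ \<Rightarrow> 0)"

lemma diag_elt_SL: "diag_elt t \<in> (SL :: (real ^ 'n::finite option ^ 'n option) set)"
proof -
  have "det (diag_elt t :: real ^ 'n option ^ 'n option) =
      (\<Prod>i\<in>UNIV. (diag_elt t :: real ^ 'n option ^ 'n option) $ i $ i)"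
    by (rule det_diagonal) (simp add: diag_elt_def)
  also have "\<dots> = exp (- real CARD('n) * t) * (\<Prod>a\<in>(UNIV::'n set). exp t)"
    unfolding UNIV_option_conv by (simp add: diag_elt_def prod.reindex)
  also have "\<dots> = 1"
    by (simp add: exp_of_nat_mult[symmetric] exp_add[symmetric])
  finally show ?thesis
    by (simp add: SL_def)
qed

lemma unip_elt_SL: "unip_elt v \<in> (SL :: (real ^ 'n::finite option ^ 'n option) set)"
proof -
  let ?A = "unip_elt v :: real ^ 'n option ^ 'n option"
  have zero: "(\<Prod>i\<in>UNIV. ?A $ i $ p i) = 0"
    if "p permutes UNIV" and "p \<noteq> id" for p
  proof -
    obtain i where i: "p i \<noteq> i"
      using \<open>p \<noteq> id\<close> by fastforce
    have inj: "inj p"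
      using that(1) by (rule permutes_inj)
    have "\<exists>j. ?A $ j $ p j = 0"
    proof (cases "p None = None")
      case True
      then have "p i \<noteq> None"
        using i inj by (metis injD)
      then show ?thesis
        using i by (intro exI[of _ i]) (auto simp: unip_elt_def split: option.splits)
    next
      case False
      then show ?thesis
        by (intro exI[of _ None]) (auto simp: unip_elt_def split: option.splits)
    qed
    then show ?thesis
      by (auto intro: prod_zero)
  qed
  have "det ?A = (\<Sum>p \<in> {id}. of_int (sign p) * (\<Prod>i\<in>UNIV. ?A $ i $ p i))"
    unfolding det_def by (rule sum.mono_neutral_right) (auto simp: permutes_id zero)
  then show ?thesis
    by (simp add: SL_def unip_elt_def sign_id)
qed

definition lattice_of_vec :: "real ^ 'n::finite \<Rightarrow> 'n option unimodular_lattice" where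
  "lattice_of_vec v = lattice_of (unip_elt v)"

definition orbit :: "'n::finite option unimodular_lattice \<Rightarrow> nat \<Rightarrow> 'n option unimodular_lattice" where
  "orbit x i = (lattice_act (diag_elt 1) ^^ i) x"


section \<open>Empirical measures and heavy lattices\<close>

text \<open>
  The push-forward of the uniform probability on \<open>{0, \<dots>, T - 1}\<close>, that is, the average of the
  Dirac masses counted with multiplicity along the orbit.
\<close>

definition empirical_measure ::
    "'n::finite option unimodular_lattice \<Rightarrow> nat \<Rightarrow> 'n option unimodular_lattice measure" where
  "empirical_measure x T = distr (uniform_count_measure {..<T}) borel (orbit x)"

lemma emeasure_empirical_measure:
  assumes "T \<ge> 1" "A \<in> sets borel"
  shows "emeasure (empirical_measure x T) A =
    (\<Sum>i<T. emeasure (return borel (orbit x i)) A) / of_nat T"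
proof -
  let ?B = "orbit x -` A \<inter> {..<T}"
  have "orbit x \<in> measurable (uniform_count_measure {..<T}) borel"
    by (simp add: measurable_def sets_uniform_count_measure space_uniform_count_measure)
  then have "emeasure (empirical_measure x T) A = ennreal (real (card ?B) / real T)"
    unfolding empirical_measure_def using assms
    by (simp add: emeasure_distr space_uniform_count_measure emeasure_uniform_count_measure)
  also have "\<dots> = of_nat (card ?B) / of_nat T"
    using assms by (simp add: divide_ennreal[symmetric] ennreal_of_nat_eq_real_of_nat)
  also have "of_nat (card ?B) = (\<Sum>i<T. emeasure (return borel (orbit x i)) A)"
    using assms by (simp add: indicator_def sum.If_cases Int_commute vimage_def Collect_conj_eq)
  finally show ?thesis .
qed

definition C0 :: "('a::topological_space \<Rightarrow> real) set" where
  "C0 = {f. continuous_on UNIV f \<and> (\<forall>e>0. \<exists>K. compact K \<and> (\<forall>x. x \<notin> K \<longrightarrow> \<bar>f x\<bar> < e))}"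

definition Cc :: "('a::topological_space \<Rightarrow> real) set" where
  "Cc = {f. continuous_on UNIV f \<and> compact (closure {x. f x \<noteq> 0})}"

definition borel_prob_measures :: "'a::topological_space measure set" where
  "borel_prob_measures = {\<mu>. sets \<mu> = sets borel \<and> prob_space \<mu>}"

text \<open>
  Weak* limits of probability measures on \<open>X\<close> may lose mass, so arbitrary finite Borel measures are
  allowed as accumulation points.
\<close>

definition weak_star_accumulation ::
    "(nat \<Rightarrow> 'a::topological_space measure) \<Rightarrow> 'a measure set" where
  "weak_star_accumulation \<mu> = {\<nu>. sets \<nu> = sets borel \<and> finite_measure \<nu> \<and>
     (\<exists>T :: nat \<Rightarrow> nat. (\<forall>k. T k \<ge> 1) \<and> filterlim T at_top sequentially \<and>
        (\<forall>f \<in> C0. (\<lambda>k. \<integral>x. f x \<partial>\<mu> (T k)) \<longlonglongrightarrow> (\<integral>x. f x \<partial>\<nu>)))}"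

definition heavy_lattice :: "'n::finite option unimodular_lattice \<Rightarrow> bool" where
  "heavy_lattice x \<longleftrightarrow>
     weak_star_accumulation (empirical_measure x) \<inter> borel_prob_measures \<noteq> {}"

definition heavy :: "real ^ 'n::finite \<Rightarrow> bool" where
  "heavy v \<longleftrightarrow> heavy_lattice (lattice_of_vec v)"

definition cutoff_sequence :: "(nat \<Rightarrow> 'a::topological_space \<Rightarrow> real) \<Rightarrow> bool" where
  "cutoff_sequence \<psi> \<longleftrightarrow>
     (\<forall>i. \<psi> i \<in> Cc) \<and> (\<forall>i x. 0 \<le> \<psi> i x \<and> \<psi> i x \<le> 1) \<and>
     (\<forall>i. compact (\<psi> i -` {1})) \<and> incseq (\<lambda>i. \<psi> i -` {1}) \<and> (\<Union>i. \<psi> i -` {1}) = UNIV"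

definition tight_prob_measures ::
    "(nat \<Rightarrow> 'a::topological_space \<Rightarrow> real) \<Rightarrow> (nat \<Rightarrow> real) \<Rightarrow> 'a measure set" where
  "tight_prob_measures \<psi> \<eta> = {\<mu> \<in> borel_prob_measures. \<forall>i. 1 - \<eta> i \<le> (\<integral>x. \<psi> i x \<partial>\<mu>)}"

definition heavy_set ::
    "(nat \<Rightarrow> 'n::finite option unimodular_lattice \<Rightarrow> real) \<Rightarrow> (nat \<Rightarrow> real)
      \<Rightarrow> 'n option unimodular_lattice set" where
  "heavy_set \<psi> \<eta> =
     {x. weak_star_accumulation (empirical_measure x) \<inter> tight_prob_measures \<psi> \<eta> \<noteq> {}}"

end

theory Submission
  imports Defs
begin

text \<open>
  The set \<open>Bad \<epsilon> v\<close> turns out to be porous at a positive proportion of scales: every return of the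
  orbit to a compact set punches holes into it. Suppose that at time \<open>i\<close> the lattice \<open>a\<^sub>i x\<^sub>v\<close> lies
  in a fixed compact set. Then it has a bounded covering radius \<open>\<rho>\<close>, so every point at height \<open>2 \<rho>\<close> has a lattice point within \<open>\<rho>\<close> of it. Undoing the flow, every ball of radius
  \<open>\<rho> exp (- i)\<close> in \<open>\<real>\<^sup>n\<close> contains a point \<open>u\<close> congruent to \<open>k v\<close> modulo \<open>\<int>\<^sup>n\<close> with \<open>k\<close> between
  \<open>\<rho> exp (n i)\<close> and \<open>3 \<rho> exp (n i)\<close> (\<open>dense_multiples_at_good_time\<close>). A vector in \<open>Bad \<epsilon> v\<close> stays,
  once \<open>k\<close> is large, at distance at least \<open>(\<epsilon> / 2) k powr (- 1 / n)\<close> from \<open>u\<close>, hence at least a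
  constant times \<open>exp (- i)\<close>. Near the scale \<open>exp (- i)\<close> every cube thus contains a hole of
  comparable size (\<open>porous_at_good_time\<close>).

  Each such time saves a fixed factor in the number of dyadic cubes that are needed to cover the set.
  If a positive proportion of the times up to \<open>T\<close> is good, the number of cubes of side \<open>exp (- T)\<close> is
  exponentially smaller than \<open>exp (n T)\<close>, and the Hausdorff dimension, which is at most the lower box
  dimension, drops below \<open>n\<close> as soon as this happens for infinitely many \<open>T\<close>
  (\<open>hausdorff_measure_0_if_often_porous\<close>). Heaviness says precisely that some limit along a sequence
  of times keeps its mass, which provides such a proportion (\<open>often_bounded_if_integral_pos\<close>). The
  gain depends on \<open>\<epsilon>\<close>, the compact set and the proportion, but not on \<open>v\<close>; a fixed tightness
  profile \<open>\<eta>\<close> fixes the last two.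

  Compactness in the space of lattices enters through \<open>lattice_size\<close>, the least norm of a basis
  matrix of determinant 1. It is bounded on compact sets, and a basis of small norm bounds the
  covering radius by rounding coordinates (\<open>lattice_covering\<close>).
\<close>


section \<open>Null sets of Hausdorff measures\<close>

lemma hausdorff_measure_eq_0I:
  fixes A :: "'a::metric_space set"
  assumes "\<And>r e. 0 < r \<Longrightarrow> 0 < e \<Longrightarrow> \<exists>U :: nat \<Rightarrow> 'a set. A \<subseteq> (\<Union>i. U i) \<and>
    (\<forall>i. bounded (U i) \<and> diameter (U i) \<le> r) \<and> (\<Sum>i. hausdorff_weight s (U i)) \<le> ennreal e"
  shows "hausdorff_measure s A = 0"
proof -
  have "hausdorff_premeasure s r A \<le> 0" if "0 < r" for r
  proof (rule ennreal_le_epsilon)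
    fix e :: real assume "0 < e"
    from assms[OF that this] obtain U :: "nat \<Rightarrow> 'a set" where
      U: "A \<subseteq> (\<Union>i. U i)" "\<forall>i. bounded (U i) \<and> diameter (U i) \<le> r"
        "(\<Sum>i. hausdorff_weight s (U i)) \<le> ennreal e" by blast
    have "hausdorff_premeasure s r A \<le> (\<Sum>i. hausdorff_weight s (U i))"
      unfolding hausdorff_premeasure_def by (rule INF_lower) (use U in auto)
    with U(3) show "hausdorff_premeasure s r A \<le> 0 + ennreal e" by simp
  qed
  then show ?thesis
    unfolding hausdorff_measure_def by (auto intro!: antisym SUP_least)
qed

lemma hausdorff_measure_0_coverE:
  fixes A :: "'a::metric_space set"
  assumes "hausdorff_measure s A = 0" "0 < r" "0 < e"
  obtains U :: "nat \<Rightarrow> 'a set" where "A \<subseteq> (\<Union>i. U i)"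
    "\<And>i. bounded (U i)" "\<And>i. diameter (U i) \<le> r" "(\<Sum>i. hausdorff_weight s (U i)) \<le> e"
proof -
  have "hausdorff_premeasure s r A \<le> hausdorff_measure s A"
    unfolding hausdorff_measure_def by (rule SUP_upper) (use assms in auto)
  then have "hausdorff_premeasure s r A < e" using assms by simp
  then show ?thesis
    unfolding hausdorff_premeasure_def INF_less_iff by (auto intro: that less_imp_le)
qed

lemma hausdorff_measure_0_UN:
  fixes A :: "nat \<Rightarrow> 'a::metric_space set"
  assumes "\<And>i. hausdorff_measure s (A i) = 0"
  shows "hausdorff_measure s (\<Union>i. A i) = 0"
proof (rule hausdorff_measure_eq_0I)
  fix r e :: real assume "0 < r" "0 < e"
  define q where "q i = ennreal (e * (1/2) ^ Suc i)" for i
  have q: "0 < q i" for i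
    using \<open>0 < e\<close> by (simp add: q_def)
  have "\<exists>U :: nat \<Rightarrow> 'a set. A i \<subseteq> (\<Union>j. U j) \<and> (\<forall>j. bounded (U j) \<and> diameter (U j) \<le> r) \<and>
      (\<Sum>j. hausdorff_weight s (U j)) \<le> q i" for i
    by (rule hausdorff_measure_0_coverE[OF assms[of i] \<open>0 < r\<close> q[of i]]) blast
  then obtain U :: "nat \<Rightarrow> nat \<Rightarrow> 'a set" where
    U: "\<And>i. A i \<subseteq> (\<Union>j. U i j)" "\<And>i j. bounded (U i j)" "\<And>i j. diameter (U i j) \<le> r"
      "\<And>i. (\<Sum>j. hausdorff_weight s (U i j)) \<le> q i"
    by metis
  define V where "V k = case_prod U (prod_decode k)" for k
  have "(\<Union>i. A i) \<subseteq> (\<Union>k. V k)"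
  proof
    fix x assume "x \<in> (\<Union>i. A i)"
    then obtain i j where "x \<in> U i j" using U(1) by blast
    then have "x \<in> V (prod_encode (i, j))" by (simp add: V_def)
    then show "x \<in> (\<Union>k. V k)" by blast
  qed
  moreover have "bounded (V k) \<and> diameter (V k) \<le> r" for k
    using U(2,3) by (simp add: V_def split: prod.split)
  moreover have "(\<Sum>k. hausdorff_weight s (V k)) \<le> ennreal e"
  proof -
    have "(\<Sum>k. hausdorff_weight s (V k)) = (\<Sum>i. \<Sum>j. hausdorff_weight s (U i j))"
      using suminf_ennreal_2dimen[of "\<lambda>i. \<Sum>j. hausdorff_weight s (U i j)"
          "\<lambda>p. hausdorff_weight s (case_prod U p)"]
      by (simp add: V_def)
    also have "\<dots> \<le> (\<Sum>i. q i)"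
      by (intro suminf_le U(4)) auto
    also have "\<dots> = ennreal e"
      unfolding q_def using \<open>0 < e\<close> sums_mult[OF power_half_series, of e]
      by (subst suminf_ennreal_eq[where x = "e * 1"]) auto
    finally show ?thesis .
  qed
  ultimately show "\<exists>U :: nat \<Rightarrow> 'a set. (\<Union>i. A i) \<subseteq> (\<Union>i. U i) \<and>
      (\<forall>i. bounded (U i) \<and> diameter (U i) \<le> r) \<and> (\<Sum>i. hausdorff_weight s (U i)) \<le> ennreal e"
    by blast
qed

lemma hausdorff_measure_mono_0:
  fixes A B :: "'a::metric_space set"
  assumes "hausdorff_measure s B = 0" "A \<subseteq> B"
  shows "hausdorff_measure s A = 0"
proof (rule hausdorff_measure_eq_0I)
  fix r e :: real assume "0 < r" "0 < e"
  then have "0 < ennreal e" by simp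
  obtain U :: "nat \<Rightarrow> 'a set" where "B \<subseteq> (\<Union>i. U i)"
    "\<And>i. bounded (U i)" "\<And>i. diameter (U i) \<le> r" "(\<Sum>i. hausdorff_weight s (U i)) \<le> ennreal e"
    using hausdorff_measure_0_coverE[OF assms(1) \<open>0 < r\<close> \<open>0 < ennreal e\<close>] by blast
  with assms(2) show "\<exists>U :: nat \<Rightarrow> 'a set. A \<subseteq> (\<Union>i. U i) \<and>
      (\<forall>i. bounded (U i) \<and> diameter (U i) \<le> r) \<and> (\<Sum>i. hausdorff_weight s (U i)) \<le> ennreal e"
    by blast
qed

text \<open>
  In terms of dimensions, a set with lower box dimension less than \<open>s\<close> is null for the \<open>s\<close>-dimensional Hausdorff measure. It suffices to have good covers at
  some arbitrarily small scales, which is why information along a subsequence of times is enough.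
\<close>

lemma hausdorff_measure_0_finite_covers:
  fixes A :: "'a::metric_space set"
  assumes "0 < s"
    and cover: "\<And>r e. 0 < r \<Longrightarrow> 0 < e \<Longrightarrow> \<exists>F b. finite F \<and> A \<subseteq> \<Union>F \<and>
      (\<forall>S\<in>F. bounded S \<and> diameter S \<le> b) \<and> b \<le> r \<and> real (card F) * b powr s \<le> e"
  shows "hausdorff_measure s A = 0"
proof (rule hausdorff_measure_eq_0I)
  fix r e :: real assume re: "0 < r" "0 < e"
  from cover[OF re] obtain F :: "'a set set" and b where F: "finite F" "A \<subseteq> \<Union>F"
    "\<And>S. S \<in> F \<Longrightarrow> bounded S" "\<And>S. S \<in> F \<Longrightarrow> diameter S \<le> b" "b \<le> r"
    "real (card F) * b powr s \<le> e" by blast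
  obtain h where h: "bij_betw h {0..<card F} F"
    using ex_bij_betw_nat_finite[OF F(1)] by blast
  define U where "U i = (if i < card F then h i else {})" for i
  have hF: "h i \<in> F" if "i < card F" for i
    using h that by (auto simp: bij_betw_def)
  have "A \<subseteq> (\<Union>i. U i)"
  proof
    fix x assume "x \<in> A"
    then obtain S where "S \<in> F" "x \<in> S" using F(2) by blast
    then obtain i where "i < card F" "h i = S"
      using h by (metis atLeastLessThan_iff bij_betw_imp_surj_on imageE)
    then show "x \<in> (\<Union>i. U i)" using \<open>x \<in> S\<close> by (auto simp: U_def)
  qed
  moreover have "bounded (U i) \<and> diameter (U i) \<le> r" for i
    using F(3,4)[OF hF[of i]] F(5) re by (auto simp: U_def)
  moreover have "(\<Sum>i. hausdorff_weight s (U i)) \<le> ennreal e"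
  proof -
    have "(\<Sum>i. hausdorff_weight s (U i)) = (\<Sum>i<card F. hausdorff_weight s (U i))"
      by (rule suminf_finite) (auto simp: U_def hausdorff_weight_def)
    also have "\<dots> \<le> (\<Sum>i<card F. ennreal (b powr s))"
    proof (rule sum_mono)
      fix i assume "i \<in> {..<card F}"
      then have i: "U i \<in> F" using hF by (auto simp: U_def)
      then have "diameter (U i) powr s \<le> b powr s"
        using F(3,4)[of "U i"] assms(1) diameter_ge_0 by (intro powr_mono2) auto
      then show "hausdorff_weight s (U i) \<le> ennreal (b powr s)"
        using assms(1) by (auto simp: hausdorff_weight_def ennreal_leI)
    qed
    also have "\<dots> = ennreal (real (card F) * b powr s)"
      by (simp add: ennreal_mult ennreal_of_nat_eq_real_of_nat)
    also have "\<dots> \<le> ennreal e" using F(6) by (rule ennreal_leI)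
    finally show ?thesis .
  qed
  ultimately show "\<exists>U :: nat \<Rightarrow> 'a set. A \<subseteq> (\<Union>i. U i) \<and>
      (\<forall>i. bounded (U i) \<and> diameter (U i) \<le> r) \<and> (\<Sum>i. hausdorff_weight s (U i)) \<le> ennreal e"
    by blast
qed

lemma hausdorff_dim_leI:
  assumes "0 \<le> s" "hausdorff_measure s A = 0"
  shows "hausdorff_dim A \<le> ereal s"
  unfolding hausdorff_dim_def by (rule INF_lower) (use assms in auto)


section \<open>Dyadic cubes and covering numbers\<close>

text \<open>
  The index of the half-open dyadic cube of side \<open>2\<^sup>-\<^sup>j\<close> that contains \<open>w\<close>. Counting indices
  rather than cubes turns the covering numbers of a set \<open>A\<close> into the cardinality of an image. Dyadic
  cubes are nested exactly, so no constant is lost when passing from one scale to the next; a constant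
  factor per scale would destroy the gain from porosity.
\<close>

definition cell :: "nat \<Rightarrow> real ^ 'n::finite \<Rightarrow> 'n \<Rightarrow> int" where
  "cell j w = (\<lambda>a. \<lfloor>2 ^ j * w $ a\<rfloor>)"

definition subcells :: "nat \<Rightarrow> ('n::finite \<Rightarrow> int) \<Rightarrow> ('n \<Rightarrow> int) set" where
  "subcells l C = PiE UNIV (\<lambda>a. {2 ^ l * C a ..< 2 ^ l * (C a + 1)})"

lemma cell_eq_iff: "cell j w = C \<longleftrightarrow> (\<forall>a. of_int (C a) \<le> 2 ^ j * w $ a \<and> 2 ^ j * w $ a < of_int (C a) + 1)"
  unfolding cell_def fun_eq_iff floor_eq_iff by simp

lemma cell_div: "cell (j + l) w a div 2 ^ l = cell j w a"
proof -
  have "\<lfloor>2 ^ j * w $ a\<rfloor> = \<lfloor>(2 ^ (j + l) * w $ a) / real_of_int (2 ^ l)\<rfloor>"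
    by (simp add: power_add)
  also have "\<dots> = \<lfloor>2 ^ (j + l) * w $ a\<rfloor> div 2 ^ l"
    by (rule floor_divide_real_eq_div) simp
  finally show ?thesis by (simp add: cell_def)
qed

lemma cell_in_subcells: "cell (j + l) w \<in> subcells l (cell j w)"
proof -
  have "2 ^ l * (x div 2 ^ l) \<le> x \<and> x < 2 ^ l * (x div 2 ^ l + 1)" for x :: int
  proof -
    have "2 ^ l * (x div 2 ^ l) + x mod 2 ^ l = x" "0 \<le> x mod 2 ^ l" "x mod 2 ^ l < 2 ^ l"
      by simp_all
    then show ?thesis unfolding distrib_left by linarith
  qed
  then show ?thesis
    unfolding subcells_def cell_div[symmetric, of j w _ l] by (auto simp: PiE_def)
qed

lemma finite_subcells: "finite (subcells l C)"
  unfolding subcells_def by (intro finite_PiE) auto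

lemma card_subcells: "card (subcells l (C :: 'n::finite \<Rightarrow> int)) = 2 ^ (l * CARD('n))"
proof -
  have "nat (2 ^ l * (C a + 1) - 2 ^ l * C a) = 2 ^ l" for a
    by (simp add: distrib_left nat_power_eq)
  then show ?thesis
    unfolding subcells_def by (simp add: card_PiE power_mult nat_power_eq)
qed

lemma card_cells_le:
  assumes fin: "finite (cell j ` A)"
    and sub: "\<And>w. w \<in> A \<Longrightarrow> card (cell (j + l) ` A \<inter> subcells l (cell j w)) \<le> K"
  shows "finite (cell (j + l) ` A)" "card (cell (j + l) ` A) \<le> card (cell j ` A) * K"
proof -
  have eq: "cell (j + l) ` A = (\<Union>C \<in> cell j ` A. cell (j + l) ` A \<inter> subcells l C)"
    using cell_in_subcells[of j l] by fastforce
  show "finite (cell (j + l) ` A)"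
    by (subst eq) (use fin finite_subcells in blast)
  have "card (cell (j + l) ` A) \<le> (\<Sum>C \<in> cell j ` A. card (cell (j + l) ` A \<inter> subcells l C))"
    by (subst eq) (rule card_UN_le[OF fin])
  also have "\<dots> \<le> (\<Sum>C \<in> cell j ` A. K)"
    by (rule sum_mono) (use sub in auto)
  finally show "card (cell (j + l) ` A) \<le> card (cell j ` A) * K" by simp
qed

lemma card_cells_refine:
  fixes A :: "(real ^ 'n::finite) set"
  assumes "finite (cell j ` A)"
  shows "finite (cell (j + l) ` A)"
    "card (cell (j + l) ` A) \<le> card (cell j ` A) * 2 ^ (l * CARD('n))"
proof -
  have "card (cell (j + l) ` A \<inter> subcells l (cell j w)) \<le> 2 ^ (l * CARD('n))" for w :: "real ^ 'n"
    using card_mono[OF finite_subcells[of l "cell j w"], of "cell (j + l) ` A \<inter> subcells l (cell j w)"]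
    by (simp add: card_subcells)
  from card_cells_le[OF assms this] show "finite (cell (j + l) ` A)"
    "card (cell (j + l) ` A) \<le> card (cell j ` A) * 2 ^ (l * CARD('n))" by auto
qed

text \<open>
  This is the gain: if every cube of level \<open>j\<close> that meets \<open>A\<close> has a descendant of level \<open>j + l\<close> that
  misses \<open>A\<close>, then at least one of its \<open>2\<^sup>l\<^sup>n\<close> descendants need not be counted.
\<close>

lemma card_cells_porous:
  fixes A :: "(real ^ 'n::finite) set"
  assumes "finite (cell j ` A)"
    and por: "\<And>w. w \<in> A \<Longrightarrow> \<exists>u. cell j u = cell j w \<and> cell (j + l) u \<notin> cell (j + l) ` A"
  shows "card (cell (j + l) ` A) \<le> card (cell j ` A) * (2 ^ (l * CARD('n)) - 1)"
proof (rule card_cells_le(2)[OF assms(1)])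
  fix w assume "w \<in> A"
  with por obtain u where u: "cell j u = cell j w" "cell (j + l) u \<notin> cell (j + l) ` A" by blast
  have "cell (j + l) u \<in> subcells l (cell j w)"
    using cell_in_subcells[of j l u] u by simp
  moreover have "cell (j + l) ` A \<inter> subcells l (cell j w) \<subseteq> subcells l (cell j w) - {cell (j + l) u}"
    using u(2) by blast
  ultimately show "card (cell (j + l) ` A \<inter> subcells l (cell j w)) \<le> 2 ^ (l * CARD('n)) - 1"
    using card_mono[OF finite_Diff[OF finite_subcells]] by (metis card_Diff_singleton card_subcells)
qed

lemma dist_le_if_same_cell:
  fixes w u :: "real ^ 'n::finite"
  assumes "cell j w = cell j u"
  shows "dist w u \<le> real CARD('n) / 2 ^ j"
proof -
  have *: "\<bar>w $ a - u $ a\<bar> < 1 / 2 ^ j" for a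
  proof -
    have "\<bar>2 ^ j * w $ a - 2 ^ j * u $ a\<bar> < 1"
      using assms[unfolded cell_eq_iff, rule_format, of a] by (simp add: cell_def) linarith
    then have "2 ^ j * \<bar>w $ a - u $ a\<bar> < 1"
      by (simp add: abs_mult flip: right_diff_distrib)
    then show ?thesis by (simp add: field_simps)
  qed
  have "dist w u \<le> (\<Sum>a\<in>UNIV. \<bar>(w - u) $ a\<bar>)"
    unfolding dist_norm by (rule norm_le_l1_cart)
  also have "\<dots> \<le> (\<Sum>a\<in>(UNIV :: 'n set). 1 / 2 ^ j)"
    by (rule sum_mono) (use * in \<open>auto intro: less_imp_le\<close>)
  finally show ?thesis by simp
qed

text \<open>
  The dyadic level whose cubes have side comparable to \<open>exp (- i)\<close>, the scale which the flow sees
  after \<open>i\<close> steps. With it every scale is indexed by the time at which it matters.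
\<close>

definition dyadic_level :: "nat \<Rightarrow> nat" where
  "dyadic_level i = nat \<lfloor>real i / ln 2\<rfloor>"

lemma dyadic_level_bounds:
  "2 ^ dyadic_level i \<le> exp (real i)" "exp (real i) < 2 * 2 ^ dyadic_level i"
proof -
  have d: "real (dyadic_level i) \<le> real i / ln 2" "real i / ln 2 < real (dyadic_level i) + 1"
    unfolding dyadic_level_def by (simp_all add: of_nat_nat)
  have p: "2 ^ dyadic_level i = exp (real (dyadic_level i) * ln 2)"
    by (simp add: exp_of_nat_mult)
  show "2 ^ dyadic_level i \<le> exp (real i)"
    unfolding p using d by (simp add: field_simps)
  have "real i < ln 2 + real (dyadic_level i) * ln 2"
    using d by (simp add: field_simps)
  then have "exp (real i) < exp (ln 2 + real (dyadic_level i) * ln 2)" by (simp only: exp_less_mono)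
  then show "exp (real i) < 2 * 2 ^ dyadic_level i"
    unfolding p by (simp add: exp_add)
qed

lemma dyadic_level_mono: "i \<le> k \<Longrightarrow> dyadic_level i \<le> dyadic_level k"
  unfolding dyadic_level_def by (intro nat_mono floor_mono divide_right_mono) auto

text \<open>
  Improvements made at good times closer than \<open>m\<close> to each other concern overlapping ranges of
  scales and cannot simply be multiplied. At a good time \<open>i\<close> the factor therefore pays for all good
  times from \<open>i - m\<close> to \<open>i\<close>, of which there are at most \<open>m + 1\<close>, while the good times before
  \<open>i - m\<close> have already lowered \<open>a i\<close> by the induction hypothesis.
\<close>

lemma decay_along_good_times:
  fixes a :: "nat \<Rightarrow> real"
  assumes dec: "\<And>i. a (Suc i) \<le> a i" and a0: "a 0 \<le> 1" and l: "0 \<le> l"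
    and good: "\<And>i. i \<in> G \<Longrightarrow> a (i + m) \<le> exp (- l * (real m + 1)) * a i"
  shows "a (J + m) \<le> exp (- l * real (card (G \<inter> {..<J})))"
proof (induction J rule: less_induct)
  case (less J)
  have mono: "a j \<le> a i" if "i \<le> j" for i j
    using that dec by (rule lift_Suc_antimono_le[rotated])
  show ?case
  proof (cases J)
    case 0
    then show ?thesis using mono[of 0 m] a0 by simp
  next
    case (Suc i)
    show ?thesis
    proof (cases "i \<in> G")
      case False
      then have "G \<inter> {..<J} = G \<inter> {..<i}" using Suc by (auto simp: less_Suc_eq)
      then show ?thesis using less[of i] mono[of "i + m" "J + m"] Suc by simp
    next
      case True
      have card: "card (G \<inter> {..<J}) \<le> card (G \<inter> {..<i - m}) + (m + 1)"
      proof -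
        have "G \<inter> {..<J} \<subseteq> (G \<inter> {..<i - m}) \<union> {i - m..<i + 1}" using Suc by auto
        then have "card (G \<inter> {..<J}) \<le> card ((G \<inter> {..<i - m}) \<union> {i - m..<i + 1})"
          by (intro card_mono) auto
        also have "\<dots> \<le> card (G \<inter> {..<i - m}) + card {i - m..<i + 1}" by (rule card_Un_le)
        finally show ?thesis by simp
      qed
      have "a i \<le> exp (- l * real (card (G \<inter> {..<i - m})))"
      proof (cases "m \<le> i")
        case True
        then show ?thesis using less[of "i - m"] Suc by simp
      next
        case False
        then show ?thesis using mono[of 0 i] a0 by simp
      qed
      then have "exp (- l * (real m + 1)) * a i \<le>
          exp (- l * (real m + 1)) * exp (- l * real (card (G \<inter> {..<i - m})))"
        by (rule mult_left_mono) simp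
      moreover have "a (J + m) \<le> a (i + m)" using mono Suc by simp
      ultimately have "a (J + m) \<le>
          exp (- l * (real m + 1)) * exp (- l * real (card (G \<inter> {..<i - m})))"
        using good[OF True] by linarith
      also have "\<dots> = exp (- l * real (card (G \<inter> {..<i - m}) + (m + 1)))"
        by (simp add: exp_add[symmetric] algebra_simps)
      also have "\<dots> \<le> exp (- l * real (card (G \<inter> {..<J})))"
        using card l by (simp add: mult_left_mono)
      finally show ?thesis .
    qed
  qed
qed


section \<open>Porosity at a positive proportion of scales\<close>

text \<open>
  A good time removes one in at most \<open>(2 exp m)\<^sup>n\<close> subcubes (see \<open>card_cells_porous\<close>, where
  \<open>2\<^sup>l \<le> 2 exp m\<close>). The rate is the resulting logarithmic gain, spread over \<open>m + 1\<close> time steps as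
  \<open>decay_along_good_times\<close> requires.
\<close>

definition decay_rate :: "nat \<Rightarrow> nat \<Rightarrow> real" where
  "decay_rate n m = - ln (1 - 1 / (2 * exp (real m)) ^ n) / (real m + 1)"

lemma decay_rate_properties:
  assumes "0 < n"
  shows "0 < decay_rate n m"
    and "exp (- decay_rate n m * (real m + 1)) = 1 - 1 / (2 * exp (real m)) ^ n"
proof -
  have "1 < (2 * exp (real m)) ^ n"
    using assms one_le_exp_iff[of "real m"] by (intro one_less_power) (linarith | simp)+
  then have x: "0 < 1 - 1 / (2 * exp (real m)) ^ n" "1 - 1 / (2 * exp (real m)) ^ n < 1"
    by (simp_all add: field_simps)
  then have "ln (1 - 1 / (2 * exp (real m)) ^ n) < 0" by (rule ln_less_zero)
  then show "0 < decay_rate n m"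
    unfolding decay_rate_def by (intro divide_pos_pos) auto
  have "- decay_rate n m * (real m + 1) = ln (1 - 1 / (2 * exp (real m)) ^ n)"
    unfolding decay_rate_def by (simp add: field_simps)
  then show "exp (- decay_rate n m * (real m + 1)) = 1 - 1 / (2 * exp (real m)) ^ n"
    using x(1) by (simp only: exp_ln)
qed

text \<open>
  If \<open>A\<close> is porous at a proportion \<open>p\<close> of the scales up to \<open>exp (- T)\<close>, the number of cubes of side
  \<open>exp (- T)\<close> meeting \<open>A\<close> is at most about \<open>exp ((n - decay_rate n m * p) * T)\<close>. This has to hold
  for infinitely many \<open>T\<close> only, as covers at these scales already determine an upper bound for the
  Hausdorff dimension. The additive constant \<open>c\<close> allows finitely many scales to be ignored.
\<close>

lemma hausdorff_measure_0_if_often_porous: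
  fixes A :: "(real ^ 'n::finite) set" and p c \<delta> :: real
  assumes A: "\<And>w. w \<in> A \<Longrightarrow> cell 0 w = C"
    and por: "\<And>i w. i \<in> G \<Longrightarrow> w \<in> A \<Longrightarrow>
      \<exists>u. cell (dyadic_level i) u = cell (dyadic_level i) w \<and>
          cell (dyadic_level (i + m)) u \<notin> cell (dyadic_level (i + m)) ` A"
    and freq: "\<exists>\<^sub>F T in sequentially. p * real T - c \<le> real (card (G \<inter> {..<T}))"
    and \<delta>: "\<delta> < real CARD('n)" "\<delta> < decay_rate CARD('n) m * p" "0 < \<delta>"
  shows "hausdorff_measure (real CARD('n) - \<delta>) A = 0"
proof -
  define n where "n = CARD('n)"
  define l where "l = decay_rate n m"
  have n: "0 < n" by (simp add: n_def)
  have l: "0 < l" unfolding l_def by (rule decay_rate_properties(1)[OF n])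
  \<comment> \<open>The Lebesgue measure of the union of the level cubes that meet \<open>A\<close>.\<close>
  define a where "a i = real (card (cell (dyadic_level i) ` A)) / 2 ^ (dyadic_level i * n)" for i
  have cell0: "cell 0 ` A \<subseteq> {C}" using A by auto
  then have fin0: "finite (cell 0 ` A)" by (rule finite_subset) simp
  have fin: "finite (cell j ` A)" for j
    using card_cells_refine(1)[OF fin0, of j] by simp
  have a_nonneg: "0 \<le> a i" for i by (simp add: a_def)
  have a0: "a 0 \<le> 1"
    using card_mono[OF _ cell0] by (simp add: a_def dyadic_level_def)
  have dec: "a (Suc i) \<le> a i" for i
  proof -
    obtain k where k: "dyadic_level (Suc i) = dyadic_level i + k"
      using dyadic_level_mono[of i "Suc i"] by (auto simp: le_iff_add)
    have "card (cell (dyadic_level i + k) ` A) \<le> card (cell (dyadic_level i) ` A) * 2 ^ (k * n)"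
      unfolding n_def by (rule card_cells_refine(2)[OF fin])
    then have "real (card (cell (dyadic_level i + k) ` A))
        \<le> real (card (cell (dyadic_level i) ` A)) * 2 ^ (k * n)"
      by (simp flip: of_nat_le_iff[where 'a = real])
    then show ?thesis
      by (simp add: a_def k field_simps power_add)
  qed
  have good: "a (i + m) \<le> exp (- l * (real m + 1)) * a i" if "i \<in> G" for i
  proof -
    obtain k where k: "dyadic_level (i + m) = dyadic_level i + k"
      using dyadic_level_mono[of i "i + m"] by (auto simp: le_iff_add)
    have "2 ^ dyadic_level i * 2 ^ k \<le> exp (real i) * exp (real m)"
      using dyadic_level_bounds(1)[of "i + m"] by (simp add: k power_add exp_add)
    also have "\<dots> \<le> (2 * 2 ^ dyadic_level i) * exp (real m)"
      using dyadic_level_bounds(2)[of i] by (intro mult_right_mono) auto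
    finally have "2 ^ k \<le> 2 * exp (real m)" by simp
    then have k_le: "2 ^ (k * n) \<le> (2 * exp (real m)) ^ n"
      unfolding power_mult by (rule power_mono) simp
    have "card (cell (dyadic_level i + k) ` A) \<le> card (cell (dyadic_level i) ` A) * (2 ^ (k * n) - 1)"
      unfolding n_def using por[OF that] by (intro card_cells_porous fin) (simp add: k)
    moreover have "real (2 ^ (k * n) - 1) = 2 ^ (k * n) - 1"
      by (simp add: of_nat_diff)
    ultimately have "real (card (cell (dyadic_level i + k) ` A))
        \<le> real (card (cell (dyadic_level i) ` A)) * (2 ^ (k * n) - 1)"
      unfolding of_nat_le_iff[where 'a = real, symmetric] of_nat_mult by simp
    then have "a (i + m) \<le> a i * ((2 ^ (k * n) - 1) / 2 ^ (k * n))"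
      by (simp add: a_def k field_simps power_add)
    also have "(2 ^ (k * n) - 1) / 2 ^ (k * n) = 1 - 1 / (2 ^ (k * n) :: real)"
      by (simp add: diff_divide_distrib)
    also have "a i * \<dots> \<le> a i * (1 - 1 / (2 * exp (real m)) ^ n)"
      using k_le a_nonneg by (intro mult_left_mono) (auto intro!: divide_left_mono)
    also have "1 - 1 / (2 * exp (real m)) ^ n = exp (- l * (real m + 1))"
      unfolding l_def decay_rate_properties(2)[OF n] ..
    finally show ?thesis by (simp add: mult.commute)
  qed
  have decay: "a (T + m) \<le> exp (- l * real (card (G \<inter> {..<T})))" for T
    using dec a0 less_imp_le[OF l] good by (rule decay_along_good_times)
  define s where "s = real n - \<delta>"
  have s: "0 < s" using \<delta> by (simp add: s_def n_def)
  define K where "K = real n powr s * exp (real m * \<delta> + l * c)"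
  define q where "q = l * p - \<delta>"
  have q: "0 < q" using \<delta> by (simp add: q_def l_def n_def)
  have "hausdorff_measure s A = 0"
  proof (rule hausdorff_measure_0_finite_covers[OF s])
    fix r e :: real assume re: "0 < r" "0 < e"
    have "(\<lambda>T. K * exp (- q) ^ T) \<longlonglongrightarrow> K * 0"
      using q by (intro tendsto_mult_left LIMSEQ_realpow_zero) auto
    then have ev1: "eventually (\<lambda>T. K * exp (- q) ^ T < e) sequentially"
      using re by (auto dest: order_tendstoD)
    have "(\<lambda>T. 2 * real n * exp (- 1) ^ T) \<longlonglongrightarrow> 2 * real n * 0"
      by (intro tendsto_mult_left LIMSEQ_realpow_zero) auto
    then have ev2: "eventually (\<lambda>T. 2 * real n * exp (- 1) ^ T < r) sequentially"
      using re by (auto dest: order_tendstoD)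
    from frequently_ex[OF frequently_eventually_conj[OF freq eventually_conj[OF ev1 ev2]]]
    obtain T where T: "p * real T - c \<le> real (card (G \<inter> {..<T}))"
      "K * exp (- q) ^ T < e" "2 * real n * exp (- 1) ^ T < r" by auto
    define j where "j = dyadic_level (T + m)"
    define b where "b = real n / 2 ^ j"
    define F where "F = (\<lambda>D. {w \<in> A. cell j w = D}) ` (cell j ` A)"
    have "finite F" unfolding F_def by (intro finite_imageI fin)
    moreover have "A \<subseteq> \<Union>F" unfolding F_def by auto
    moreover have "bounded S \<and> diameter S \<le> b" if "S \<in> F" for S
    proof -
      have d: "dist x y \<le> b" if "x \<in> S" "y \<in> S" for x y
        using \<open>S \<in> F\<close> that unfolding F_def b_def n_def by (intro dist_le_if_same_cell) auto
      then have "bounded S" unfolding bounded_two_points by blast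
      moreover have "diameter S \<le> b"
        using d by (intro diameter_le) (auto simp: b_def dist_norm)
      ultimately show ?thesis ..
    qed
    moreover have "b \<le> r"
    proof -
      have "exp (real T) \<le> exp (real (T + m))" by simp
      also have "\<dots> \<le> 2 * 2 ^ j"
        unfolding j_def using dyadic_level_bounds(2)[of "T + m"] by simp
      finally have "b \<le> 2 * real n / exp (real T)"
        unfolding b_def by (auto simp: field_simps intro: mult_left_mono)
      also have "\<dots> = 2 * real n * exp (- 1) ^ T"
        by (simp add: exp_of_nat_mult[symmetric] exp_minus field_simps)
      finally show ?thesis using T(3) by simp
    qed
    moreover have "real (card F) * b powr s \<le> e"
    proof -
      have "real (card F) \<le> real (card (cell j ` A))"
        unfolding F_def using card_image_le[OF fin[of j]] by simp
      also have "\<dots> = a (T + m) * 2 ^ (j * n)"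
        by (simp add: a_def j_def)
      finally have "real (card F) * b powr s \<le> a (T + m) * 2 ^ (j * n) * b powr s"
        by (rule mult_right_mono) simp
      also have "\<dots> = real n powr s * a (T + m) * (2 ^ j) powr \<delta>"
      proof -
        have "2 ^ (j * n) = ((2::real) ^ j) powr (real n)"
          by (simp add: power_mult powr_realpow)
        also have "real n = s + \<delta>" by (simp add: s_def)
        finally have "2 ^ (j * n) = ((2::real) ^ j) powr s * (2 ^ j) powr \<delta>"
          by (simp add: powr_add)
        then show ?thesis unfolding b_def by (simp add: powr_divide)
      qed
      also have "\<dots> \<le> real n powr s * exp (- l * (p * real T - c)) * exp (real (T + m) * \<delta>)"
      proof -
        have "a (T + m) \<le> exp (- l * (p * real T - c))"
          by (rule order_trans[OF decay]) (use T(1) l in simp)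
        moreover have "(2 ^ j) powr \<delta> \<le> exp (real (T + m)) powr \<delta>"
          unfolding j_def using dyadic_level_bounds(1)[of "T + m"] \<delta>(3)
          by (intro powr_mono2) auto
        then have "(2 ^ j) powr \<delta> \<le> exp (real (T + m) * \<delta>)"
          by (simp add: powr_def mult.commute)
        ultimately show ?thesis
          using a_nonneg by (intro mult_mono) auto
      qed
      also have "\<dots> = K * exp (- q * real T)"
        unfolding K_def q_def by (simp add: exp_add[symmetric] algebra_simps)
      also have "exp (- q * real T) = exp (- q) ^ T"
        using exp_of_nat_mult[of T "- q"] by (simp add: mult.commute)
      finally show ?thesis using T(2) by simp
    qed
    ultimately show "\<exists>F b. finite F \<and> A \<subseteq> \<Union>F \<and> (\<forall>S\<in>F. bounded S \<and> diameter S \<le> b) \<and>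
        b \<le> r \<and> real (card F) * b powr s \<le> e" by blast
  qed
  then show ?thesis by (simp add: s_def n_def)
qed


section \<open>The least norm of a basis of a lattice\<close>

text \<open>
  The operator norm is used on matrices because it is submultiplicative and directly bounds
  displacements; its comparison with the Euclidean norm gives continuity and compactness.
\<close>

abbreviation mnorm :: "real ^ 'd ^ 'd \<Rightarrow> real" where
  "mnorm g \<equiv> onorm ((*v) g)"

lemma mnorm_bound: "norm (g *v x) \<le> mnorm g * norm (x :: real ^ 'd::finite)"
  by (rule onorm) simp

lemma mnorm_nonneg: "0 \<le> mnorm (g :: real ^ 'd::finite ^ 'd)"
  by (rule onorm_pos_le) simp

lemma mnorm_mult: "mnorm (g ** h) \<le> mnorm g * mnorm (h :: real ^ 'd::finite ^ 'd)"
  using onorm_compose[of "(*v) g" "(*v) h"] by (simp add: o_def matrix_vector_mul_assoc)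

lemma mnorm_near_1:
  fixes h :: "real ^ 'd::finite ^ 'd"
  assumes "mnorm (h - mat 1) \<le> e" "e < 1"
  shows "mnorm h \<le> 1 + e" and "h ** k = mat 1 \<Longrightarrow> mnorm k \<le> 1 / (1 - e)"
proof -
  have *: "norm (h *v x - x) \<le> e * norm x" for x
  proof -
    have "h *v x - x = (h - mat 1) *v x" by (simp add: matrix_vector_mult_diff_rdistrib)
    then show ?thesis
      using mnorm_bound[of "h - mat 1" x] mult_right_mono[OF assms(1), of "norm x"] by simp
  qed
  show "mnorm h \<le> 1 + e"
  proof (rule onorm_le)
    fix x show "norm (h *v x) \<le> (1 + e) * norm x"
      using *[of x] norm_triangle_sub[of "h *v x" x] by (simp add: distrib_right)
  qed
  assume k: "h ** k = mat 1"
  show "mnorm k \<le> 1 / (1 - e)"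
  proof (rule onorm_le)
    fix x
    have "h *v (k *v x) = x" using k by (simp add: matrix_vector_mul_assoc)
    then have "(1 - e) * norm (k *v x) \<le> norm x"
      using *[of "k *v x"] norm_triangle_sub[of "k *v x" x]
      by (simp add: left_diff_distrib norm_minus_commute)
    then show "norm (k *v x) \<le> 1 / (1 - e) * norm x"
      using assms(2) by (simp add: field_simps)
  qed
qed

lemma mnorm_le_norm:
  fixes g :: "real ^ 'd::finite ^ 'd"
  shows "mnorm g \<le> real CARD('d) * real CARD('d) * norm g"
proof -
  have "mnorm g \<le> (\<Sum>i\<in>UNIV. \<Sum>j\<in>UNIV. \<bar>g $ i $ j\<bar>)" by (rule onorm_le_matrix_component_sum)
  also have "\<dots> \<le> (\<Sum>i\<in>(UNIV :: 'd set). \<Sum>j\<in>(UNIV :: 'd set). norm g)"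
    by (intro sum_mono order_trans[OF component_le_norm_cart Finite_Cartesian_Product.norm_nth_le])
  finally show ?thesis by simp
qed

lemma norm_le_mnorm:
  fixes g :: "real ^ 'd::finite ^ 'd"
  shows "norm g \<le> real CARD('d) * real CARD('d) * mnorm g"
proof -
  have "norm g \<le> (\<Sum>i\<in>UNIV. norm (g $ i))" by (simp add: norm_vec_def L2_set_le_sum)
  also have "\<dots> \<le> (\<Sum>i\<in>UNIV. \<Sum>j\<in>UNIV. \<bar>g $ i $ j\<bar>)"
    by (intro sum_mono norm_le_l1_cart)
  also have "\<dots> \<le> (\<Sum>i\<in>(UNIV :: 'd set). \<Sum>j\<in>(UNIV :: 'd set). mnorm g)"
  proof (intro sum_mono)
    fix i j :: 'd
    have "\<bar>g $ i $ j\<bar> = \<bar>(g *v axis j 1) $ i\<bar>" by (simp add: matrix_vector_mult_basis column_def)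
    also have "\<dots> \<le> norm (g *v axis j 1)" by (rule component_le_norm_cart)
    also have "\<dots> \<le> mnorm g" using mnorm_bound[of g "axis j 1"] by simp
    finally show "\<bar>g $ i $ j\<bar> \<le> mnorm g" .
  qed
  finally show ?thesis by simp
qed

lemma SL_mult: "g \<in> SL \<Longrightarrow> h \<in> SL \<Longrightarrow> g ** h \<in> SL"
  by (simp add: SL_def det_mul)

lemma SL_inverse:
  assumes "g \<in> SL"
  obtains k where "k \<in> SL" "g ** k = mat 1" "k ** g = mat 1"
proof -
  have "invertible g" using assms by (simp add: SL_def invertible_det_nz)
  then obtain k where k: "g ** k = mat 1" "k ** g = mat 1" unfolding invertible_def by blast
  have "det g * det k = 1" using k(1) by (metis det_I det_mul)
  then have "k \<in> SL" using assms by (simp add: SL_def)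
  with k show ?thesis by (rule that[rotated])
qed

lemma lattice_of_cong_left:
  assumes "lattice_of g = lattice_of h" "g \<in> SL" "h \<in> SL"
  shows "lattice_of (k ** g) = lattice_of (k ** h)"
  using assms by (metis lattice_act_lattice_of)

text \<open>
  The infimum is over all bases of the lattice. This function measures how far a lattice is in the
  cusp: it is continuous, it has relatively compact sublevel sets, and it controls the covering
  radius, because a basis of small norm has a small fundamental domain.
\<close>

definition lattice_size :: "'d::finite unimodular_lattice \<Rightarrow> real" where
  "lattice_size L = (INF g \<in> {g \<in> SL. lattice_of g = L}. mnorm g)"

lemma lattice_size_le: "g \<in> SL \<Longrightarrow> lattice_size (lattice_of g) \<le> mnorm g"
  unfolding lattice_size_def
  by (rule cINF_lower) (auto intro!: bdd_belowI2[where m = 0] mnorm_nonneg)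

lemma lattice_size_nonneg: "0 \<le> lattice_size L"
  unfolding lattice_size_def using lattice_of_surj[of L]
  by (intro cINF_greatest) (auto intro: mnorm_nonneg)

lemma lattice_size_lessE:
  assumes "lattice_size L < R"
  obtains g where "g \<in> SL" "lattice_of g = L" "mnorm g < R"
proof -
  have "{g \<in> SL. lattice_of g = L} \<noteq> {}" using lattice_of_surj[of L] by auto
  then have "\<exists>g \<in> {g \<in> SL. lattice_of g = L}. mnorm g < R"
    using assms unfolding lattice_size_def
    by (subst (asm) cINF_less_iff) (auto intro!: bdd_belowI2[where m = 0] mnorm_nonneg)
  then show ?thesis using that by auto
qed

lemma lattice_size_mult_le:
  assumes "k \<in> SL" "g \<in> SL"
  shows "lattice_size (lattice_of (k ** g)) \<le> mnorm k * lattice_size (lattice_of g)"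
proof (rule dense_ge)
  fix y assume y: "mnorm k * lattice_size (lattice_of g) < y"
  show "lattice_size (lattice_of (k ** g)) \<le> y"
  proof (cases "mnorm k = 0")
    case True
    have "lattice_size (lattice_of (k ** g)) \<le> mnorm k * mnorm g"
      using lattice_size_le[OF SL_mult[OF assms]] mnorm_mult[of k g] by linarith
    then show ?thesis using True y by simp
  next
    case False
    then have "0 < mnorm k" using mnorm_nonneg[of k] by linarith
    then have "lattice_size (lattice_of g) < y / mnorm k" using y by (simp add: field_simps)
    then obtain h where h: "h \<in> SL" "lattice_of h = lattice_of g" "mnorm h < y / mnorm k"
      by (rule lattice_size_lessE)
    have "lattice_size (lattice_of (k ** g)) = lattice_size (lattice_of (k ** h))"
      using lattice_of_cong_left[OF h(2,1) assms(2)] by simp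
    also have "\<dots> \<le> mnorm (k ** h)" by (rule lattice_size_le[OF SL_mult[OF assms(1) h(1)]])
    also have "\<dots> \<le> mnorm k * mnorm h" by (rule mnorm_mult)
    also have "\<dots> \<le> y" using h(3) \<open>0 < mnorm k\<close> by (simp add: field_simps)
    finally show ?thesis .
  qed
qed

lemma continuous_on_lattice_iff:
  fixes f :: "'d::finite unimodular_lattice \<Rightarrow> 'b::topological_space"
  shows "continuous_on UNIV f \<longleftrightarrow> continuous_on SL (\<lambda>g. f (lattice_of g))"
proof -
  have "open (f -` B) \<longleftrightarrow> openin (top_of_set SL) (SL \<inter> (\<lambda>g. f (lattice_of g)) -` B)" for B
    unfolding open_unimodular_lattice_def by (simp add: Int_def vimage_def)
  then show ?thesis
    by (simp add: continuous_on_open_vimage continuous_on_open_gen[where T = UNIV] continuous_openin_preimage_eq)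
qed

lemma continuous_on_lattice_of: "continuous_on SL (lattice_of :: _ \<Rightarrow> 'd::finite unimodular_lattice)"
  using continuous_on_lattice_iff[of "\<lambda>L. L :: 'd unimodular_lattice"] by simp

text \<open>
  If \<open>h\<close> is close to \<open>g\<close>, then \<open>h = (h g\<^sup>-\<^sup>1) g\<close>, where \<open>h g\<^sup>-\<^sup>1\<close> and its inverse have norm
  close to 1. By \<open>lattice_size_mult_le\<close> the two sizes have a ratio close to 1.
\<close>

lemma continuous_lattice_size: "continuous_on UNIV (lattice_size :: 'd::finite unimodular_lattice \<Rightarrow> real)"
  unfolding continuous_on_lattice_iff unfolding continuous_on_def
proof
  fix g :: "real ^ 'd ^ 'd" assume g: "g \<in> SL"
  then obtain k where k: "k \<in> SL" "g ** k = mat 1" "k ** g = mat 1" by (rule SL_inverse)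
  define N where "N h = lattice_size (lattice_of h)" for h :: "real ^ 'd ^ 'd"
  define e where "e h = real CARD('d) * real CARD('d) * norm (h ** k - mat 1)" for h
  have e: "(e \<longlongrightarrow> 0) (at g within SL)"
  proof -
    have "continuous_on UNIV (\<lambda>h. h ** k)"
      unfolding matrix_matrix_mult_def by (intro continuous_intros)
    then have "continuous_on UNIV e" unfolding e_def by (intro continuous_intros)
    then have "isCont e g" by (simp add: continuous_on_eq_continuous_at)
    then have "(e \<longlongrightarrow> e g) (at g within SL)" unfolding isCont_def by (rule tendsto_within_subset) simp
    then show ?thesis by (simp add: e_def k)
  qed
  have bounds: "(1 - e h) * N g \<le> N h \<and> N h \<le> (1 + e h) * N g" if "h \<in> SL" "e h < 1" for h
  proof -
    have m: "mnorm (h ** k - mat 1) \<le> e h" unfolding e_def by (rule mnorm_le_norm)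
    have hk: "h ** k \<in> SL" using that k(1) by (intro SL_mult)
    have "(h ** k) ** g = h" by (simp add: k matrix_mul_assoc[symmetric])
    then have "N h \<le> mnorm (h ** k) * N g"
      using lattice_size_mult_le[OF hk g] by (simp add: N_def)
    also have "\<dots> \<le> (1 + e h) * N g"
      by (intro mult_right_mono mnorm_near_1(1)[OF m that(2)]) (simp add: N_def lattice_size_nonneg)
    finally have up: "N h \<le> (1 + e h) * N g" .
    obtain r where r: "r \<in> SL" "(h ** k) ** r = mat 1" "r ** (h ** k) = mat 1"
      using hk by (rule SL_inverse)
    have "r ** h = r ** ((h ** k) ** g)" using \<open>(h ** k) ** g = h\<close> by simp
    also have "\<dots> = g" using r(3) by (simp add: matrix_mul_assoc)
    finally have "N g \<le> mnorm r * N h"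
      using lattice_size_mult_le[OF r(1) that(1)] by (simp add: N_def)
    also have "\<dots> \<le> 1 / (1 - e h) * N h"
      by (intro mult_right_mono mnorm_near_1(2)[OF m that(2) r(2)])
        (simp add: N_def lattice_size_nonneg)
    finally show ?thesis using up that(2) by (simp add: field_simps)
  qed
  have "((\<lambda>h. (1 - e h) * N g) \<longlongrightarrow> (1 - 0) * N g) (at g within SL)"
    "((\<lambda>h. (1 + e h) * N g) \<longlongrightarrow> (1 + 0) * N g) (at g within SL)"
    by (intro tendsto_intros e)+
  then have lim: "((\<lambda>h. (1 - e h) * N g) \<longlongrightarrow> N g) (at g within SL)"
    "((\<lambda>h. (1 + e h) * N g) \<longlongrightarrow> N g) (at g within SL)"
    by simp_all
  have "\<forall>\<^sub>F h in at g within SL. h \<in> SL \<and> e h < 1"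
    by (intro eventually_conj order_tendstoD(2)[OF e]) (auto simp: eventually_at_filter)
  then have ev: "\<forall>\<^sub>F h in at g within SL. (1 - e h) * N g \<le> N h"
    "\<forall>\<^sub>F h in at g within SL. N h \<le> (1 + e h) * N g"
    by (auto elim!: eventually_mono dest: bounds)
  have "(N \<longlongrightarrow> N g) (at g within SL)"
    by (rule tendsto_sandwich[OF ev lim])
  then show "((\<lambda>h. lattice_size (lattice_of h)) \<longlongrightarrow> lattice_size (lattice_of g)) (at g within SL)"
    unfolding N_def[abs_def] .
qed

lemma lattice_size_sublevel_compact:
  fixes R :: real
  shows "\<exists>K :: 'd::finite unimodular_lattice set. compact K \<and> {L. lattice_size L < R} \<subseteq> K"
proof -
  define S where "S = SL \<inter> {g :: real ^ 'd ^ 'd. norm g \<le> real CARD('d) * real CARD('d) * R}"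
  have "closed (SL :: (real ^ 'd ^ 'd) set)"
  proof -
    have "continuous_on UNIV (det :: real ^ 'd ^ 'd \<Rightarrow> real)"
      unfolding det_def by (intro continuous_intros)
    from closed_vimage[OF closed_singleton this, of 1] show ?thesis
      by (simp add: SL_def vimage_def)
  qed
  moreover have "{g :: real ^ 'd ^ 'd. norm g \<le> r} = cball 0 r" for r
    by auto
  ultimately have "compact S"
    unfolding S_def using closed_Int_compact compact_cball by metis
  then have "compact (lattice_of ` S)"
    by (intro compact_continuous_image continuous_on_subset[OF continuous_on_lattice_of]) (auto simp: S_def)
  moreover have "{L. lattice_size L < R} \<subseteq> lattice_of ` S"
  proof
    fix L :: "'d unimodular_lattice" assume "L \<in> {L. lattice_size L < R}"
    then obtain g where g: "g \<in> SL" "lattice_of g = L" "mnorm g < R"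
      using lattice_size_lessE by blast
    have "norm g \<le> real CARD('d) * real CARD('d) * mnorm g" by (rule norm_le_mnorm)
    also have "\<dots> \<le> real CARD('d) * real CARD('d) * R" using g(3) by (intro mult_left_mono) auto
    finally show "L \<in> lattice_of ` S" using g by (auto simp: S_def)
  qed
  ultimately show ?thesis by blast
qed

lemma lattice_size_bounded_on_compact:
  fixes K :: "'d::finite unimodular_lattice set"
  assumes "compact K"
  obtains R where "0 < R" "\<And>L. L \<in> K \<Longrightarrow> lattice_size L < R"
proof -
  have "compact (lattice_size ` K)"
    using assms by (intro compact_continuous_image continuous_on_subset[OF continuous_lattice_size]) auto
  then obtain B where "\<And>L. L \<in> K \<Longrightarrow> norm (lattice_size L) \<le> B"
    using compact_imp_bounded[of "lattice_size ` K"] unfolding bounded_iff by auto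
  then have "lattice_size L < \<bar>B\<bar> + 1" if "L \<in> K" for L using that by fastforce
  then show ?thesis by (intro that[of "\<bar>B\<bar> + 1"]) auto
qed

text \<open>
  Express \<open>y\<close> in a basis of the lattice with small norm and round the coordinates. The basis \<open>g\<close> that
  does this may differ from the given \<open>h\<close>, but both have the same lattice.
\<close>

lemma lattice_covering:
  fixes y :: "real ^ 'd::finite"
  assumes h: "h \<in> SL" and "lattice_size (lattice_of h) < R"
  obtains q where "q \<in> integer_vectors" "norm (y - h *v q) \<le> R * real CARD('d)"
proof -
  obtain g where g: "g \<in> SL" "lattice_of g = lattice_of h" "mnorm g < R"
    using assms(2) by (rule lattice_size_lessE)
  obtain k where k: "k \<in> SL" "g ** k = mat 1" "k ** g = mat 1" using g(1) by (rule SL_inverse)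
  define x where "x = k *v y"
  define z where "z = (\<chi> i. real_of_int \<lfloor>x $ i\<rfloor>)"
  have z: "z \<in> integer_vectors" by (simp add: z_def integer_vectors_def)
  have "norm (x - z) \<le> (\<Sum>i\<in>UNIV. \<bar>(x - z) $ i\<bar>)" by (rule norm_le_l1_cart)
  also have "\<dots> \<le> (\<Sum>i\<in>(UNIV :: 'd set). 1)"
    by (rule sum_mono) (simp add: z_def, linarith)
  finally have xz: "norm (x - z) \<le> real CARD('d)" by simp
  have "y - g *v z = g *v (x - z)"
    by (simp add: x_def matrix_vector_mult_diff_distrib matrix_vector_mul_assoc k)
  then have "norm (y - g *v z) \<le> mnorm g * norm (x - z)" using mnorm_bound by metis
  also have "\<dots> \<le> R * real CARD('d)"
    using g(3) xz mnorm_nonneg[of g] by (intro mult_mono) auto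
  finally have n: "norm (y - g *v z) \<le> R * real CARD('d)" .
  have "(\<lambda>z. g *v z) ` integer_vectors = (\<lambda>z. h *v z) ` integer_vectors"
    using g(1,2) h Rep_lattice_of by metis
  then obtain q where "q \<in> integer_vectors" "g *v z = h *v q" using z by blast
  then show ?thesis using n that by metis
qed


section \<open>Bounded lattices in the orbit create holes\<close>

lemma diag_elt_mult:
  "diag_elt s ** diag_elt t = (diag_elt (s + t) :: real ^ 'n::finite option ^ 'n option)"
proof -
  have "(diag_elt s ** diag_elt t) $ i $ j = (diag_elt (s + t) :: real ^ 'n option ^ 'n option) $ i $ j"
    for i j :: "'n option"
  proof -
    have "(diag_elt s ** diag_elt t) $ i $ j =
        (\<Sum>k\<in>UNIV. if k = i then (diag_elt s :: real ^ 'n option ^ 'n option) $ i $ i * diag_elt t $ i $ j else 0)"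
      unfolding matrix_matrix_mult_def vec_lambda_beta by (rule sum.cong) (auto simp: diag_elt_def)
    also have "\<dots> = (diag_elt (s + t) :: real ^ 'n option ^ 'n option) $ i $ j"
      by (auto simp: diag_elt_def exp_add[symmetric] algebra_simps split: option.split)
    finally show ?thesis .
  qed
  then show ?thesis by (simp add: vec_eq_iff)
qed

lemma orbit_lattice_of_vec:
  "orbit (lattice_of_vec v) i = lattice_of (diag_elt (real i) ** unip_elt v)"
proof (induction i)
  case 0
  have "diag_elt 0 = (mat 1 :: real ^ 'a option ^ 'a option)"
    by (auto simp: diag_elt_def mat_def vec_eq_iff split: option.split)
  then show ?case by (simp add: orbit_def lattice_of_vec_def)
next
  case (Suc i)
  have "orbit (lattice_of_vec v) (Suc i) = lattice_act (diag_elt 1) (orbit (lattice_of_vec v) i)"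
    by (simp add: orbit_def)
  also have "\<dots> = lattice_of (diag_elt 1 ** (diag_elt (real i) ** unip_elt v))"
    unfolding Suc by (intro lattice_act_lattice_of SL_mult diag_elt_SL unip_elt_SL)
  also have "\<dots> = lattice_of (diag_elt (real (Suc i)) ** unip_elt v)"
    by (simp add: matrix_mul_assoc diag_elt_mult)
  finally show ?case .
qed

lemma sum_option_UNIV: "(\<Sum>k\<in>UNIV. f k) = f None + (\<Sum>a\<in>(UNIV :: 'n::finite set). f (Some a))"
  unfolding UNIV_option_conv by (simp add: sum.reindex)

lemma flow_coordinates:
  fixes v :: "real ^ 'n::finite"
  shows "((diag_elt t ** unip_elt v) *v q) $ Some a = exp t * (q $ Some a + q $ None * v $ a)"
    and "((diag_elt t ** unip_elt v) *v q) $ None = exp (- real CARD('n) * t) * q $ None"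
proof -
  let ?u = "unip_elt v *v q"
  have unip: "unip_elt v $ Some a $ None = v $ a" "unip_elt v $ None $ None = 1"
    "unip_elt v $ None $ Some b = 0" "unip_elt v $ Some a $ Some b = (if a = b then 1 else 0)" for a b
    by (simp_all add: unip_elt_def)
  have u: "?u $ Some a = q $ Some a + q $ None * v $ a" "?u $ None = q $ None" for a
  proof -
    show "?u $ Some a = q $ Some a + q $ None * v $ a"
      unfolding matrix_vector_mult_def
      by (simp add: sum_option_UNIV unip if_distrib[where f = "\<lambda>x. x * _"] cong: if_cong)
    show "?u $ None = q $ None"
      unfolding matrix_vector_mult_def by (simp add: sum_option_UNIV unip)
  qed
  have d: "(diag_elt t *v x) $ i = diag_elt t $ i $ i * x $ i" for x :: "real ^ 'n option" and i
  proof -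
    have "(diag_elt t *v x) $ i = (\<Sum>k\<in>UNIV. if k = i then diag_elt t $ i $ i * x $ i else 0)"
      unfolding matrix_vector_mult_def vec_lambda_beta by (rule sum.cong) (auto simp: diag_elt_def)
    then show ?thesis by simp
  qed
  show "((diag_elt t ** unip_elt v) *v q) $ Some a = exp t * (q $ Some a + q $ None * v $ a)"
    unfolding matrix_vector_mul_assoc[symmetric] d u by (simp add: diag_elt_def)
  show "((diag_elt t ** unip_elt v) *v q) $ None = exp (- real CARD('n) * t) * q $ None"
    unfolding matrix_vector_mul_assoc[symmetric] d u by (simp add: diag_elt_def)
qed

text \<open>
  The covering property is applied to the point with last coordinate \<open>2 \<rho>\<close> and other coordinates
  \<open>exp i * w\<close>. The last coordinate of a lattice point near it is then between \<open>\<rho>\<close> and \<open>3 \<rho>\<close>, which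
  forces \<open>k\<close> to be positive and of exact order \<open>exp (n i)\<close>: a lower bound alone would give no
  control of the radius \<open>k powr (- 1 / n)\<close> on which badly approximable vectors are excluded.
\<close>

lemma dense_multiples_at_good_time:
  fixes v w :: "real ^ 'n::finite"
  assumes size: "lattice_size (orbit (lattice_of_vec v) i) < R"
  defines "\<rho> \<equiv> R * real (Suc CARD('n))"
  obtains k :: nat and u where "\<rho> * exp (real CARD('n) * real i) \<le> real k"
    "real k \<le> 3 * \<rho> * exp (real CARD('n) * real i)"
    "real k *\<^sub>R v - u \<in> integer_vectors"
    "\<And>a. \<bar>u $ a - w $ a\<bar> \<le> \<rho> * exp (- real i)"
proof -
  have "0 < R" using size lattice_size_nonneg[of "orbit (lattice_of_vec v) i"] by linarith
  then have rho: "0 < \<rho>" by (simp add: \<rho>_def)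
  let ?h = "diag_elt (real i) ** unip_elt v"
  define y :: "real ^ 'n option" where
    "y = (\<chi> j. case j of None \<Rightarrow> 2 * \<rho> | Some a \<Rightarrow> exp (real i) * w $ a)"
  have "?h \<in> SL" by (intro SL_mult diag_elt_SL unip_elt_SL)
  then obtain q where q: "q \<in> integer_vectors" "norm (y - ?h *v q) \<le> R * real CARD('n option)"
    using lattice_covering size orbit_lattice_of_vec by metis
  have comp: "\<bar>y $ j - (?h *v q) $ j\<bar> \<le> \<rho>" for j
    using component_le_norm_cart[of "y - ?h *v q" j] q(2) by (simp add: \<rho>_def)
  define E where "E = exp (real CARD('n) * real i)"
  have "\<bar>2 * \<rho> - q $ None / E\<bar> \<le> \<rho>"
    using comp[of None] unfolding flow_coordinates(2) by (simp add: y_def E_def exp_minus field_simps)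
  then have "\<rho> \<le> q $ None / E" "q $ None / E \<le> 3 * \<rho>" by linarith+
  then have range: "\<rho> * E \<le> q $ None" "q $ None \<le> 3 * \<rho> * E"
    by (simp_all add: E_def field_simps)
  have "0 \<le> \<rho> * E" using rho by (simp add: E_def)
  with range have pos: "0 \<le> q $ None" by linarith
  moreover have "q $ None \<in> \<int>" using q(1) by (simp add: integer_vectors_def)
  ultimately obtain k :: nat where k: "q $ None = real k"
    by (metis Ints_cases nonneg_int_cases of_int_0_le_iff of_int_of_nat_eq)
  define u where "u = (\<chi> a. q $ Some a + real k * v $ a)"
  have "\<bar>u $ a - w $ a\<bar> \<le> \<rho> * exp (- real i)" for a
  proof -
    have "\<bar>exp (real i) * w $ a - exp (real i) * u $ a\<bar> \<le> \<rho>"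
      using comp[of "Some a"] unfolding flow_coordinates(1) by (simp add: y_def u_def k)
    then have "exp (real i) * \<bar>u $ a - w $ a\<bar> \<le> \<rho>"
      by (simp add: abs_mult abs_minus_commute flip: right_diff_distrib)
    then show ?thesis by (simp add: exp_minus field_simps)
  qed
  moreover have "real k *\<^sub>R v - u \<in> integer_vectors"
    using q(1) by (simp add: integer_vectors_def u_def)
  ultimately show ?thesis using range unfolding k E_def by (intro that)
qed

text \<open>
  Near the centre of the dyadic cube of \<open>w\<close> there is a point \<open>u\<close> congruent to \<open>k v\<close> modulo integer
  vectors, with \<open>k\<close> of order \<open>exp (n (i + \<kappa>))\<close>. No element of \<open>A\<close> is closer to \<open>u\<close> than a constant
  times \<open>exp (- i)\<close>, so a sufficiently small subcube around \<open>u\<close> misses \<open>A\<close>. The delay \<open>\<kappa>\<close> makes \<open>u\<close>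
  close enough to the centre to lie in the same cube as \<open>w\<close>, and the depth \<open>m\<close> makes the subcube
  smaller than the excluded ball.
\<close>

lemma porous_at_good_time:
  fixes v :: "real ^ 'n::finite"
  assumes size: "lattice_size (orbit (lattice_of_vec v) (i + \<kappa>)) < R"
  defines "\<rho> \<equiv> R * real (Suc CARD('n))"
  assumes \<kappa>: "2 * \<rho> < exp (real \<kappa>)"
    and m: "(3 * \<rho>) powr (1 / real CARD('n)) * (2 * real CARD('n) * exp (real \<kappa>)) \<le> \<epsilon> * exp (real m)"
    and N: "real N \<le> \<rho> * exp (real CARD('n) * real (i + \<kappa>))"
    and A: "\<And>w k. w \<in> A \<Longrightarrow> N \<le> k \<Longrightarrow>
      \<epsilon> \<le> real k powr (1 / real CARD('n)) * dist_to_integers (real k *\<^sub>R v - w)"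
  shows "\<exists>u. cell (dyadic_level i) u = cell (dyadic_level i) w \<and>
             cell (dyadic_level (i + m)) u \<notin> cell (dyadic_level (i + m)) ` A"
proof -
  let ?n = "real CARD('n)"
  define j where "j = dyadic_level i"
  define J where "J = dyadic_level (i + m)"
  \<comment> \<open>The centre of the dyadic cube that contains \<open>w\<close>.\<close>
  define x where "x = (\<chi> a. (real_of_int (cell j w a) + 1 / 2) / 2 ^ j)"
  have "0 < R" using size lattice_size_nonneg[of "orbit (lattice_of_vec v) (i + \<kappa>)"] by linarith
  then have rho: "0 < \<rho>" by (simp add: \<rho>_def)
  obtain k :: nat and u where k: "\<rho> * exp (?n * real (i + \<kappa>)) \<le> real k"
    "real k \<le> 3 * \<rho> * exp (?n * real (i + \<kappa>))"
    and u: "real k *\<^sub>R v - u \<in> integer_vectors"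
    "\<And>a. \<bar>u $ a - x $ a\<bar> \<le> \<rho> * exp (- real (i + \<kappa>))"
    using dense_multiples_at_good_time[OF size, of x] unfolding \<rho>_def by blast
  have "cell j u = cell j w"
    unfolding cell_eq_iff
  proof
    fix a
    have "2 ^ j * (\<rho> * exp (- real (i + \<kappa>))) \<le> exp (real i) * (\<rho> * exp (- real (i + \<kappa>)))"
      using dyadic_level_bounds(1)[of i] rho unfolding j_def by (intro mult_right_mono) auto
    also have "\<dots> = \<rho> / exp (real \<kappa>)" by (simp add: exp_minus exp_add exp_diff field_simps)
    also have "\<dots> < 1 / 2" using \<kappa> by (simp add: field_simps)
    finally have "2 ^ j * (\<rho> * exp (- real (i + \<kappa>))) < 1 / 2" .
    moreover have "2 ^ j * \<bar>u $ a - x $ a\<bar> \<le> 2 ^ j * (\<rho> * exp (- real (i + \<kappa>)))"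
      using u(2)[of a] by (rule mult_left_mono) simp
    ultimately have "2 ^ j * \<bar>u $ a - x $ a\<bar> < 1 / 2" by linarith
    then have "\<bar>2 ^ j * u $ a - 2 ^ j * x $ a\<bar> < 1 / 2"
      by (simp add: abs_mult flip: right_diff_distrib)
    moreover have "2 ^ j * x $ a = of_int (cell j w a) + 1 / 2" by (simp add: x_def)
    ultimately show "of_int (cell j w a) \<le> 2 ^ j * u $ a \<and> 2 ^ j * u $ a < of_int (cell j w a) + 1"
      by linarith
  qed
  moreover have "cell J u \<notin> cell J ` A"
  proof
    assume "cell J u \<in> cell J ` A"
    then obtain w' where w': "w' \<in> A" "cell J u = cell J w'" by blast
    have "dist_to_integers (real k *\<^sub>R v - w') \<le> dist (real k *\<^sub>R v - w') (real k *\<^sub>R v - u)"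
      unfolding dist_to_integers_def using u(1) by (rule infdist_le)
    also have "\<dots> = dist u w'" by (simp add: dist_norm)
    also have "\<dots> \<le> ?n / 2 ^ J" by (rule dist_le_if_same_cell[OF w'(2)])
    also have "\<dots> < ?n * (2 / exp (real (i + m)))"
      using dyadic_level_bounds(2)[of "i + m"] unfolding J_def by (simp add: field_simps)
    finally have d: "dist_to_integers (real k *\<^sub>R v - w') < ?n * (2 / exp (real (i + m)))" .
    have "0 < \<rho> * exp (?n * real (i + \<kappa>))" using rho by simp
    with k(1) have kpos: "0 < real k" by linarith
    have "N \<le> k" using N k(1) by linarith
    then have "\<epsilon> \<le> real k powr (1 / ?n) * dist_to_integers (real k *\<^sub>R v - w')"
      using A w'(1) by blast
    also have "\<dots> < real k powr (1 / ?n) * (?n * (2 / exp (real (i + m))))"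
      using d kpos by (intro mult_strict_left_mono) auto
    also have "\<dots> \<le> ((3 * \<rho>) powr (1 / ?n) * exp (real (i + \<kappa>))) * (?n * (2 / exp (real (i + m))))"
    proof (rule mult_right_mono)
      have "real k powr (1 / ?n) \<le> (3 * \<rho> * exp (?n * real (i + \<kappa>))) powr (1 / ?n)"
        using k(2) by (intro powr_mono2) auto
      also have "\<dots> = (3 * \<rho>) powr (1 / ?n) * exp (real (i + \<kappa>))"
        using rho by (simp add: powr_mult exp_powr_real)
      finally show "real k powr (1 / ?n) \<le> (3 * \<rho>) powr (1 / ?n) * exp (real (i + \<kappa>))" .
    qed simp
    also have "\<dots> = (3 * \<rho>) powr (1 / ?n) * (2 * ?n * exp (real \<kappa>)) / exp (real m)"
      by (simp add: exp_add field_simps)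
    also have "\<dots> \<le> \<epsilon>" using m by (simp add: field_simps)
    finally show False by simp
  qed
  ultimately show ?thesis unfolding j_def J_def by blast
qed


section \<open>Heavy vectors\<close>

lemma Bad_subset_UN:
  fixes v :: "real ^ 'n::finite"
  assumes "0 < \<epsilon>"
  shows "Bad \<epsilon> v \<subseteq> (\<Union>N. {w. \<forall>k\<ge>N.
    \<epsilon> / 2 \<le> real k powr (1 / real CARD('n)) * dist_to_integers (real k *\<^sub>R v - w)})"
proof
  fix w assume "w \<in> Bad \<epsilon> v"
  moreover have "ereal (\<epsilon> / 2) < ereal \<epsilon>" using assms by simp
  ultimately have "\<forall>\<^sub>F k in sequentially.
      ereal (\<epsilon> / 2) < ereal (real k powr (1 / real CARD('n)) * dist_to_integers (real k *\<^sub>R v - w))"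
    unfolding Bad_def le_Liminf_iff by blast
  then obtain N where "\<forall>k\<ge>N.
      \<epsilon> / 2 < real k powr (1 / real CARD('n)) * dist_to_integers (real k *\<^sub>R v - w)"
    unfolding eventually_sequentially by auto
  then show "w \<in> (\<Union>N. {w. \<forall>k\<ge>N.
    \<epsilon> / 2 \<le> real k powr (1 / real CARD('n)) * dist_to_integers (real k *\<^sub>R v - w)})"
    by (auto intro: less_imp_le)
qed

lemma frequently_card_shift:
  fixes P :: "nat \<Rightarrow> bool"
  assumes "\<exists>\<^sub>F T in sequentially. p * real T \<le> real (card {i. i < T \<and> P i})"
  shows "\<exists>\<^sub>F T in sequentially.
    p * real T - real (\<kappa> + i0) \<le> real (card ({i. P (i + \<kappa>) \<and> i0 \<le> i} \<inter> {..<T}))"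
  using assms
proof (rule frequently_elim1)
  fix T assume T: "p * real T \<le> real (card {i. i < T \<and> P i})"
  let ?G = "{i. P (i + \<kappa>) \<and> i0 \<le> i} \<inter> {..<T}"
  have "{i. i < T \<and> P i} \<subseteq> {..<\<kappa> + i0} \<union> (\<lambda>i. i + \<kappa>) ` ?G"
  proof
    fix i assume i: "i \<in> {i. i < T \<and> P i}"
    show "i \<in> {..<\<kappa> + i0} \<union> (\<lambda>i. i + \<kappa>) ` ?G"
    proof (cases "i < \<kappa> + i0")
      case False
      then have "i - \<kappa> \<in> ?G" "i = (i - \<kappa>) + \<kappa>" using i by auto
      then show ?thesis by blast
    qed simp
  qed
  then have "card {i. i < T \<and> P i} \<le> card ({..<\<kappa> + i0} \<union> (\<lambda>i. i + \<kappa>) ` ?G)"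
    by (intro card_mono) auto
  also have "\<dots> \<le> card {..<\<kappa> + i0} + card ((\<lambda>i. i + \<kappa>) ` ?G)" by (rule card_Un_le)
  also have "\<dots> \<le> (\<kappa> + i0) + card ?G" by (simp add: card_image_le)
  finally show "p * real T - real (\<kappa> + i0) \<le> real (card ?G)" using T by linarith
qed

text \<open>
  The constants \<open>\<kappa>\<close> and \<open>m\<close>, and with them \<open>\<delta>\<close>, are chosen from \<open>\<epsilon>\<close>, \<open>p\<close> and \<open>R\<close> before \<open>v\<close> is
  fixed; this is the source of the uniformity. The vector \<open>v\<close> and the index from which
  the defining inequality of \<open>Bad\<close> holds affect only how many initial scales have to be ignored.
\<close>

lemma hausdorff_dim_Bad_le_if_often_bounded:
  fixes \<epsilon> p R :: real
  assumes \<epsilon>: "0 < \<epsilon>" and p: "0 < p" and R: "0 < R"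
  obtains \<delta> where "0 < \<delta>"
    "\<And>v :: real ^ 'n::finite.
      \<exists>\<^sub>F T in sequentially. p * real T \<le>
        real (card {i. i < T \<and> lattice_size (orbit (lattice_of_vec v) i) < R}) \<Longrightarrow>
      hausdorff_dim (Bad \<epsilon> v) \<le> ereal (real CARD('n) - \<delta>)"
proof -
  let ?n = "real CARD('n)"
  define \<rho> where "\<rho> = R * real (Suc CARD('n))"
  have rho: "0 < \<rho>" using R by (simp add: \<rho>_def)
  have ex_exp: "\<exists>k. x < exp (real k)" for x
  proof -
    obtain k where "x < real k" using reals_Archimedean2 by blast
    then show ?thesis using exp_ge_add_one_self[of "real k"] by (intro exI[of _ k]) linarith
  qed
  obtain \<kappa> where \<kappa>: "2 * \<rho> < exp (real \<kappa>)" using ex_exp by blast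
  obtain m where "(3 * \<rho>) powr (1 / ?n) * (2 * ?n * exp (real \<kappa>)) / (\<epsilon> / 2) < exp (real m)"
    using ex_exp by blast
  then have m: "(3 * \<rho>) powr (1 / ?n) * (2 * ?n * exp (real \<kappa>)) \<le> \<epsilon> / 2 * exp (real m)"
    using \<epsilon> by (simp add: field_simps)
  define \<delta> where "\<delta> = min ?n (decay_rate CARD('n) m * p) / 2"
  have "0 < decay_rate CARD('n) m * p" using decay_rate_properties(1)[of "CARD('n)" m] p by simp
  then have \<delta>: "\<delta> < ?n" "\<delta> < decay_rate CARD('n) m * p" "0 < \<delta>"
    unfolding \<delta>_def by (auto simp: min_def field_simps)
  have "hausdorff_dim (Bad \<epsilon> v) \<le> ereal (?n - \<delta>)"
    if freq: "\<exists>\<^sub>F T in sequentially. p * real T \<le>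
        real (card {i. i < T \<and> lattice_size (orbit (lattice_of_vec v) i) < R})" for v :: "real ^ 'n"
  proof -
    define B where "B N = {w. \<forall>k\<ge>N.
      \<epsilon> / 2 \<le> real k powr (1 / ?n) * dist_to_integers (real k *\<^sub>R v - w)}" for N :: nat
    \<comment> \<open>Restricting to a unit cube gives finite covering numbers.\<close>
    define A where "A N C = {w \<in> B N. cell 0 w = C}" for N C
    have null: "hausdorff_measure (?n - \<delta>) (A N C) = 0" for N C
    proof -
      \<comment> \<open>From this time on, the multiples of \<open>v\<close> that create the holes have index at least \<open>N\<close>.\<close>
      define i0 where "i0 = nat \<lceil>real N / \<rho>\<rceil>"
      define G where "G = {i. lattice_size (orbit (lattice_of_vec v) (i + \<kappa>)) < R \<and> i0 \<le> i}"
      have late: "real N \<le> \<rho> * exp (?n * real (i + \<kappa>))" if "i0 \<le> i" for i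
      proof -
        have "real N / \<rho> \<le> real i0" unfolding i0_def by (rule real_nat_ceiling_ge)
        also have "\<dots> \<le> real (i + \<kappa>)" using that by simp
        also have "\<dots> \<le> ?n * real (i + \<kappa>)"
          using mult_right_mono[of 1 ?n "real (i + \<kappa>)"] by (simp add: Suc_leI)
        also have "\<dots> \<le> exp (?n * real (i + \<kappa>))"
          using exp_ge_add_one_self[of "?n * real (i + \<kappa>)"] by linarith
        finally show ?thesis using rho by (simp add: field_simps)
      qed
      have por: "\<exists>u. cell (dyadic_level i) u = cell (dyadic_level i) w \<and>
          cell (dyadic_level (i + m)) u \<notin> cell (dyadic_level (i + m)) ` A N C"
        if "i \<in> G" for i and w :: "real ^ 'n"
        using that \<kappa> m late unfolding \<rho>_def G_def
        by (intro porous_at_good_time[where \<kappa> = \<kappa> and R = R and \<epsilon> = "\<epsilon> / 2" and N = N and v = v])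
          (auto simp: A_def B_def)
      have "\<exists>\<^sub>F T in sequentially. p * real T - real (\<kappa> + i0) \<le> real (card (G \<inter> {..<T}))"
        using frequently_card_shift[OF freq, of \<kappa> i0] unfolding G_def .
      then show ?thesis
        by (rule hausdorff_measure_0_if_often_porous[OF _ por _ \<delta>, rotated 2]) (auto simp: A_def)
    qed
    have "hausdorff_measure (?n - \<delta>) (\<Union>i. case_prod A (from_nat i)) = 0"
      by (rule hausdorff_measure_0_UN) (simp add: null split: prod.split)
    moreover have "Bad \<epsilon> v \<subseteq> (\<Union>i. case_prod A (from_nat i))"
    proof
      fix w assume "w \<in> Bad \<epsilon> v"
      then obtain N where "w \<in> B N" using Bad_subset_UN[OF \<epsilon>, of v] unfolding B_def by blast
      then have "w \<in> case_prod A (from_nat (to_nat (N, cell 0 w)))" by (simp add: A_def)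
      then show "w \<in> (\<Union>i. case_prod A (from_nat i))" by (rule UN_I[OF UNIV_I])
    qed
    ultimately have "hausdorff_measure (?n - \<delta>) (Bad \<epsilon> v) = 0" by (rule hausdorff_measure_mono_0)
    then show ?thesis using \<delta>(1) by (intro hausdorff_dim_leI) auto
  qed
  then show ?thesis using \<delta>(3) that by blast
qed

lemma integral_empirical_measure:
  fixes f :: "'n::finite option unimodular_lattice \<Rightarrow> real"
  assumes "continuous_on UNIV f"
  shows "(\<integral>L. f L \<partial>empirical_measure x T) = (\<Sum>i<T. f (orbit x i)) / real T"
proof -
  have "orbit x \<in> measurable (uniform_count_measure {..<T}) borel"
    by (simp add: measurable_def sets_uniform_count_measure space_uniform_count_measure)
  then show ?thesis
    unfolding empirical_measure_def
    by (simp add: integral_distr borel_measurable_continuous_onI[OF assms] integral_uniform_count_measure)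
qed

text \<open>
  The integral of \<open>f\<close> against an empirical measure is at most \<open>M\<close> times the proportion of times at
  which the orbit visits a sublevel set that carries \<open>f\<close>. Weak* convergence to a measure that gives \<open>f\<close> a positive
  integral bounds this proportion below along a sequence of times.
\<close>

lemma often_bounded_if_integral_pos:
  fixes f :: "'n::finite option unimodular_lattice \<Rightarrow> real"
  assumes \<nu>: "\<nu> \<in> weak_star_accumulation (empirical_measure x)"
    and f: "f \<in> C0" "\<And>L. f L \<le> M" "0 < M" "\<And>L. R \<le> lattice_size L \<Longrightarrow> f L = 0"
    and c: "c < (\<integral>L. f L \<partial>\<nu>)"
  shows "\<exists>\<^sub>F T in sequentially. c / M * real T \<le> real (card {i. i < T \<and> lattice_size (orbit x i) < R})"
proof -
  have cont: "continuous_on UNIV f" using f(1) by (simp add: C0_def)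
  obtain T :: "nat \<Rightarrow> nat" where T: "\<And>k. T k \<ge> 1" "filterlim T at_top sequentially"
    "(\<lambda>k. \<integral>L. f L \<partial>empirical_measure x (T k)) \<longlonglongrightarrow> (\<integral>L. f L \<partial>\<nu>)"
    using \<nu> f(1) unfolding weak_star_accumulation_def by blast
  have bound: "(\<Sum>i<t. f (orbit x i)) \<le> M * real (card {i. i < t \<and> lattice_size (orbit x i) < R})" for t
  proof -
    have "(\<Sum>i<t. f (orbit x i)) \<le> (\<Sum>i<t. if lattice_size (orbit x i) < R then M else 0)"
      by (rule sum_mono) (auto simp: f)
    also have "\<dots> = M * real (card {i. i < t \<and> lattice_size (orbit x i) < R})"
      by (simp add: sum.If_cases Int_def mult.commute)
    finally show ?thesis .
  qed
  have ev: "\<forall>\<^sub>F k in sequentially. c / M * real (T k) \<le>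
      real (card {i. i < T k \<and> lattice_size (orbit x i) < R})"
    using order_tendstoD(1)[OF T(3) c]
  proof eventually_elim
    case (elim k)
    then have "c * real (T k) \<le> (\<Sum>i<T k. f (orbit x i))"
      using T(1)[of k] by (simp add: integral_empirical_measure[OF cont] field_simps)
    then show ?case using bound[of "T k"] f(3) by (simp add: field_simps)
  qed
  show ?thesis
  proof (rule ccontr)
    assume "\<not> ?thesis"
    then have "\<forall>\<^sub>F k in sequentially. \<not> c / M * real (T k) \<le>
        real (card {i. i < T k \<and> lattice_size (orbit x i) < R})"
      unfolding not_frequently by (rule eventually_compose_filterlim[OF _ T(2)])
    then have "\<forall>\<^sub>F k in sequentially. False" using ev by eventually_elim blast
    then show False by simp
  qed
qed

lemma C0_I_vanishing:
  assumes "continuous_on UNIV f" "compact K" "\<And>x. x \<notin> K \<Longrightarrow> f x = 0"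
  shows "f \<in> C0"
  unfolding C0_def
proof (intro CollectI conjI allI impI exI[of _ K] assms(1,2))
  fix e :: real and x assume "0 < e" "x \<notin> K"
  then show "\<bar>f x\<bar> < e" by (simp add: assms(3))
qed

lemma Cc_subset_C0: "Cc \<subseteq> C0"
proof
  fix f :: "'a::topological_space \<Rightarrow> real" assume "f \<in> Cc"
  then show "f \<in> C0"
    using closure_subset[of "{x. f x \<noteq> 0}"]
    by (intro C0_I_vanishing[of _ "closure {x. f x \<noteq> 0}"]) (simp_all only: Cc_def mem_Collect_eq, blast)
qed

lemma lattice_size_bump_C0: "(\<lambda>L :: 'd::finite unimodular_lattice. max 0 (R - lattice_size L)) \<in> C0"
proof -
  obtain K :: "'d unimodular_lattice set" where K: "compact K" "{L. lattice_size L < R} \<subseteq> K"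
    using lattice_size_sublevel_compact by blast
  have "max 0 (R - lattice_size L) = 0" if "L \<notin> K" for L
  proof -
    have "\<not> lattice_size L < R" using that K(2) by blast
    then show ?thesis by simp
  qed
  then show ?thesis
    by (intro C0_I_vanishing[OF _ K(1)] continuous_intros continuous_lattice_size)
qed

text \<open>
  The total mass 1 lies on the union of the sets where these functions are positive, so it cannot
  escape all of them.
\<close>

lemma prob_integral_bump_pos:
  fixes \<mu> :: "'d::finite unimodular_lattice measure"
  assumes "\<mu> \<in> borel_prob_measures"
  obtains R where "0 < R" "0 < (\<integral>L. max 0 (R - lattice_size L) \<partial>\<mu>)"
proof -
  interpret prob_space \<mu> using assms by (simp add: borel_prob_measures_def)
  have sets [measurable_cong]: "sets \<mu> = sets borel" using assms by (simp add: borel_prob_measures_def)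
  define f where "f r L = max 0 (real r - lattice_size L)" for r :: nat and L :: "'d unimodular_lattice"
  have meas: "f r \<in> borel_measurable \<mu>" for r
  proof -
    have "continuous_on UNIV (f r)"
      unfolding f_def by (intro continuous_intros continuous_lattice_size)
    from borel_measurable_continuous_onI[OF this] show ?thesis
      using measurable_cong_sets[OF sets refl] by blast
  qed
  have int: "integrable \<mu> (f r)" for r
    using meas by (intro integrable_const_bound[of _ "real r"]) (auto simp: f_def lattice_size_nonneg)
  have nonneg: "AE L in \<mu>. 0 \<le> f r L" for r by (simp add: f_def)
  have "\<exists>r. (\<integral>L. f r L \<partial>\<mu>) \<noteq> 0"
  proof (rule ccontr)
    assume "\<not> ?thesis"
    then have "AE L in \<mu>. f r L = 0" for r
      using integral_nonneg_eq_0_iff_AE[OF int nonneg] by auto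
    then have zero: "AE L in \<mu>. \<forall>r. f r L = 0" by (simp add: AE_all_countable)
    have pos: "\<exists>r. f r L \<noteq> 0" for L
    proof -
      obtain r :: nat where "lattice_size L < real r" using reals_Archimedean2 by blast
      then show ?thesis by (intro exI[of _ r]) (simp add: f_def)
    qed
    from zero have "AE L in \<mu>. False"
    proof eventually_elim
      case (elim L)
      then show ?case using pos[of L] by blast
    qed
    then show False by simp
  qed
  then obtain r where r: "(\<integral>L. f r L \<partial>\<mu>) \<noteq> 0" by blast
  then have "0 < (\<integral>L. f r L \<partial>\<mu>)" using integral_nonneg_AE[OF nonneg[of r]] by linarith
  moreover have "r \<noteq> 0"
  proof
    assume "r = 0"
    then have "f r L = 0" for L using lattice_size_nonneg[of L] by (simp add: f_def)
    then show False using r by simp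
  qed
  ultimately show ?thesis by (intro that[of "real r"]) (auto simp: f_def)
qed

lemma heavy_imp_hausdorff_dim_Bad_less:
  fixes v :: "real ^ 'n::finite"
  assumes "heavy v" "0 < \<epsilon>"
  shows "hausdorff_dim (Bad \<epsilon> v) < ereal (real CARD('n))"
proof -
  obtain \<mu> where \<mu>: "\<mu> \<in> weak_star_accumulation (empirical_measure (lattice_of_vec v))"
    "\<mu> \<in> borel_prob_measures"
    using assms(1) unfolding heavy_def heavy_lattice_def by blast
  obtain R where R: "0 < R" "0 < (\<integral>L. max 0 (R - lattice_size L) \<partial>\<mu>)"
    using prob_integral_bump_pos[OF \<mu>(2)] by blast
  then obtain c where c: "0 < c" "c < (\<integral>L. max 0 (R - lattice_size L) \<partial>\<mu>)"
    using dense by blast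
  obtain \<delta> where \<delta>: "0 < \<delta>" "\<And>v :: real ^ 'n. \<exists>\<^sub>F T in sequentially. c / R * real T \<le>
        real (card {i. i < T \<and> lattice_size (orbit (lattice_of_vec v) i) < R}) \<Longrightarrow>
      hausdorff_dim (Bad \<epsilon> v) \<le> ereal (real CARD('n) - \<delta>)"
    using hausdorff_dim_Bad_le_if_often_bounded[OF assms(2) divide_pos_pos[OF c(1) R(1)] R(1)] by blast
  have "\<exists>\<^sub>F T in sequentially. c / R * real T \<le>
      real (card {i. i < T \<and> lattice_size (orbit (lattice_of_vec v) i) < R})"
    using R(1) c(2) lattice_size_nonneg
    by (intro often_bounded_if_integral_pos[OF \<mu>(1) lattice_size_bump_C0]) auto
  then have "hausdorff_dim (Bad \<epsilon> v) \<le> ereal (real CARD('n) - \<delta>)" by (rule \<delta>(2))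
  also have "\<dots> < ereal (real CARD('n))" using \<delta>(1) by simp
  finally show ?thesis .
qed

text \<open>
  One index \<open>i\<close> with \<open>\<eta> i < 1 / 2\<close> is enough: it gives a compact set, fixed by \<open>\<psi>\<close> and \<open>\<eta>\<close>
  alone, which the orbit of every lattice in \<open>heavy_set \<psi> \<eta>\<close> visits at half or more of the times up to
  infinitely many \<open>T\<close>.
\<close>

lemma tight_imp_uniform_hausdorff_dim_Bad_le:
  fixes \<psi> :: "nat \<Rightarrow> 'n::finite option unimodular_lattice \<Rightarrow> real"
  assumes \<psi>: "cutoff_sequence \<psi>" and \<eta>: "\<eta> \<longlonglongrightarrow> 0" and \<epsilon>: "0 < \<epsilon>"
  obtains \<delta> where "0 < \<delta>" "\<And>v :: real ^ 'n. lattice_of_vec v \<in> heavy_set \<psi> \<eta> \<Longrightarrow>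
    hausdorff_dim (Bad \<epsilon> v) \<le> ereal (real CARD('n) - \<delta>)"
proof -
  have "\<forall>\<^sub>F i in sequentially. \<eta> i < 1 / 2" using order_tendstoD(2)[OF \<eta>, of "1 / 2"] by simp
  then obtain i where i: "\<eta> i < 1 / 2" using eventually_happens by fastforce
  have Cc: "\<psi> i \<in> Cc" and le1: "\<And>L. \<psi> i L \<le> 1" using \<psi> by (simp_all add: cutoff_sequence_def)
  obtain R where R: "0 < R" "\<And>L. L \<in> closure {L. \<psi> i L \<noteq> 0} \<Longrightarrow> lattice_size L < R"
    using lattice_size_bounded_on_compact Cc unfolding Cc_def by blast
  have supp: "\<psi> i L = 0" if "R \<le> lattice_size L" for L
    using R(2)[of L] that closure_subset[of "{L. \<psi> i L \<noteq> 0}"] by fastforce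
  obtain \<delta> where \<delta>: "0 < \<delta>" "\<And>v :: real ^ 'n. \<exists>\<^sub>F T in sequentially. 1 / 2 * real T \<le>
        real (card {i. i < T \<and> lattice_size (orbit (lattice_of_vec v) i) < R}) \<Longrightarrow>
      hausdorff_dim (Bad \<epsilon> v) \<le> ereal (real CARD('n) - \<delta>)"
    using hausdorff_dim_Bad_le_if_often_bounded[OF \<epsilon> _ R(1), of "1 / 2"] by auto
  have "hausdorff_dim (Bad \<epsilon> v) \<le> ereal (real CARD('n) - \<delta>)"
    if heavy: "lattice_of_vec v \<in> heavy_set \<psi> \<eta>" for v :: "real ^ 'n"
  proof (rule \<delta>(2))
    obtain \<mu> where \<mu>: "\<mu> \<in> weak_star_accumulation (empirical_measure (lattice_of_vec v))"
      "1 - \<eta> i \<le> (\<integral>L. \<psi> i L \<partial>\<mu>)"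
      using heavy unfolding heavy_set_def tight_prob_measures_def by blast
    then have "1 / 2 < (\<integral>L. \<psi> i L \<partial>\<mu>)" using i by linarith
    with often_bounded_if_integral_pos[OF \<mu>(1) subsetD[OF Cc_subset_C0 Cc] le1 _ supp]
    show "\<exists>\<^sub>F T in sequentially. 1 / 2 * real T \<le>
        real (card {i. i < T \<and> lattice_size (orbit (lattice_of_vec v) i) < R})"
      by fastforce
  qed
  then show ?thesis using \<delta>(1) that by blast
qed

theorem theorem5p3:
  shows "(\<forall>v :: real ^ 'n::finite. heavy v \<longrightarrow>
            (\<forall>\<epsilon>>0. hausdorff_dim (Bad \<epsilon> v) < ereal (real CARD('n))))
       \<and> (\<forall>\<psi> :: nat \<Rightarrow> 'n option unimodular_lattice \<Rightarrow> real. cutoff_sequence \<psi> \<longrightarrow>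
            (\<forall>\<eta> :: nat \<Rightarrow> real. (\<forall>i. 0 \<le> \<eta> i) \<and> \<eta> \<longlonglongrightarrow> 0 \<longrightarrow>
              (\<forall>\<epsilon>>0. \<exists>\<delta>>0. \<forall>v :: real ^ 'n. lattice_of_vec v \<in> heavy_set \<psi> \<eta> \<longrightarrow>
                 hausdorff_dim (Bad \<epsilon> v) \<le> ereal (real CARD('n) - \<delta>))))"
proof (intro conjI allI impI)
  fix v :: "real ^ 'n" and \<epsilon> :: real
  assume "heavy v" "0 < \<epsilon>"
  then show "hausdorff_dim (Bad \<epsilon> v) < ereal (real CARD('n))"
    by (rule heavy_imp_hausdorff_dim_Bad_less)
next
  fix \<psi> :: "nat \<Rightarrow> 'n option unimodular_lattice \<Rightarrow> real" and \<eta> :: "nat \<Rightarrow> real" and \<epsilon> :: real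
  assume "cutoff_sequence \<psi>" "(\<forall>i. 0 \<le> \<eta> i) \<and> \<eta> \<longlonglongrightarrow> 0" "0 < \<epsilon>"
  then show "\<exists>\<delta>>0. \<forall>v :: real ^ 'n. lattice_of_vec v \<in> heavy_set \<psi> \<eta> \<longrightarrow>
      hausdorff_dim (Bad \<epsilon> v) \<le> ereal (real CARD('n) - \<delta>)"
    using tight_imp_uniform_hausdorff_dim_Bad_le[of \<psi> \<eta> \<epsilon>] by blast
qed

end
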